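(* Let $p$ be a mixture-of-Gaussians density on $\mathcal{X}=\mathbb{R}^D$, and consider the associated gradient system $$\frac{d\boldsymbol{x}}{dt}=R(\boldsymbol{x})^{-1}\nabla\ln p(\boldsymbol{x})=-R(\boldsymbol{x})^{-1}\sum_{k=1}^K\omega_k(\boldsymbol{x})\boldsymbol{\Sigma}_k^{-1}(\boldsymbol{x}-\boldsymbol{\mu}_k),$$ where $R(\cdot)$ is a Riemannian metric on $\mathcal{X}$. Suppose that $R(\cdot)$ has a finite condition number on $\mathcal{X}$, i.e. $\sup_{\boldsymbol{x}\in\mathcal{X}}\kappa(R(\boldsymbol{x}))<\infty$. Let $\boldsymbol{x}^0_1,\dots,\boldsymbol{x}^0_s$ be the stable equilibrium vectors of the system. Then the whole data space is almost surely a pairwise disjoint union of their basin cells: $$\mathcal{X}=\mathfrak{B}(\boldsymbol{x}^0_1)\,\dot\cup\cdots\dot\cup\,\mathfrak{B}(\boldsymbol{x}^0_s),$$ that is, $\mathcal{X}=\bigcup_{i=1}^s\mathfrak{B}(\boldsymbol{x}^0_i)$ and $\mathfrak{B}(\boldsymbol{x}^0_i)\cap\mathfrak{B}(\boldsymbol{x}^0_j)$ has Lebesgue measure zero for all $i\neq j$.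
   Context: The mixture-of-Gaussians density is $p(\boldsymbol{x})=\sum_{k=1}^K\pi_k g_k(\boldsymbol{x})$ with $g_k(\boldsymbol{x})=(2\pi)^{-D/2}|\boldsymbol{\Sigma}_k|^{-1/2}e^{-\frac12(\boldsymbol{x}-\boldsymbol{\mu}_k)^T\boldsymbol{\Sigma}_k^{-1}(\boldsymbol{x}-\boldsymbol{\mu}_k)}$, where $\boldsymbol{\mu}_k\in\mathbb{R}^D$, $\boldsymbol{\Sigma}_k\in\mathbb{R}^{D\times D}$ is symmetric positive definite, $\pi_k>0$ and $\sum_k\pi_k=1$. The weights are $\omega_k(\boldsymbol{x})=\pi_k g_k(\boldsymbol{x})/\sum_{l}\pi_l g_l(\boldsymbol{x})>0$. Put $f=-\ln p$. A Riemannian metric $R$ on $\mathcal{X}$ is a smooth map assigning to each $\boldsymbol{x}\in\mathcal{X}$ a symmetric positive definite matrix $R(\boldsymbol{x})\in\mathbb{R}^{D\times D}$; $\kappa(\cdot)$ denotes the spectral condition number (ratio of largest to smallest eigenvalue). Standing assumptions: $f$ is a Morse function, i.e. the Hessian of $f$ is nonsingular at every $\boldsymbol{x}$ with $\nabla f(\boldsymbol{x})=0$ (such points are called equilibrium vectors); and the solution trajectory $\boldsymbol{x}(t)$ of the system is defined for all $t\in\mathbb{R}$ for every initial condition $\boldsymbol{x}(0)\in\mathcal{X}$. A stable equilibrium vector is an equilibrium vector at which the Hessian of $f$ is positive definite (equivalently, a local minimum of $f$, an asymptotically stable equilibrium of the system). The basin cell of a stable equilibrium vector $\boldsymbol{x}^0$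 is the closure $\mathfrak{B}(\boldsymbol{x}^0)=\mathrm{cl}\{\boldsymbol{x}(0)\in\mathcal{X}:\lim_{t\to\infty}\boldsymbol{x}(t)=\boldsymbol{x}^0\}$. *)

theory Defs
  imports "HOL-Analysis.Analysis"
begin

definition pos_def :: "real^'n^'n \<Rightarrow> bool" where
  "pos_def A \<longleftrightarrow> (\<forall>v. v \<noteq> 0 \<longrightarrow> 0 < v \<bullet> (A *v v))"

definition sym_pos_def :: "real^'n^'n \<Rightarrow> bool" where
  "sym_pos_def A \<longleftrightarrow> transpose A = A \<and> pos_def A"

definition eigenvalues :: "real^'n^'n \<Rightarrow> real set" where
  "eigenvalues A = {c. \<exists>v. v \<noteq> 0 \<and> A *v v = c *\<^sub>R v}"

(* Used for symmetric positive definite matrices only: there the set of (real) eigenvalues is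
   finite, nonempty and consists of positive numbers. *)
definition cond_number :: "real^'n^'n \<Rightarrow> real" where
  "cond_number A = Max (eigenvalues A) / Min (eigenvalues A)"

definition grad :: "(real^'n \<Rightarrow> real) \<Rightarrow> real^'n \<Rightarrow> real^'n" where
  "grad f x = (THE D. GDERIV f x :> D)"

definition hessian :: "(real^'n \<Rightarrow> real) \<Rightarrow> real^'n \<Rightarrow> real^'n^'n" where
  "hessian f x = jacobian (grad f) (at x)"

(* C^k on the whole space: all iterated partial derivatives up to order k exist and are
   continuous. *)
fun C_upto :: "nat \<Rightarrow> (real^'n \<Rightarrow> 'b::real_normed_vector) \<Rightarrow> bool" where
  "C_upto 0 f \<longleftrightarrow> continuous_on UNIV f"
| "C_upto (Suc k) f \<longleftrightarrow>
     (\<forall>x. f differentiable (at x)) \<and>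
     (\<forall>i. C_upto k (\<lambda>x. frechet_derivative f (at x) (axis i 1)))"

definition smooth :: "(real^'n \<Rightarrow> 'b::real_normed_vector) \<Rightarrow> bool" where
  "smooth f \<longleftrightarrow> (\<forall>k. C_upto k f)"

definition riemannian_metric :: "(real^'n \<Rightarrow> real^'n^'n) \<Rightarrow> bool" where
  "riemannian_metric R \<longleftrightarrow> smooth R \<and> (\<forall>x. sym_pos_def (R x))"

definition finite_condition_number :: "(real^'n \<Rightarrow> real^'n^'n) \<Rightarrow> bool" where
  "finite_condition_number R \<longleftrightarrow> bdd_above (range (\<lambda>x. cond_number (R x)))"

definition gauss :: "real^'n \<Rightarrow> real^'n^'n \<Rightarrow> real^'n \<Rightarrow> real" where
  "gauss m S x =
     (2 * pi) powr (- real CARD('n) / 2) * det S powr (- 1 / 2) *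
     exp (- 1 / 2 * ((x - m) \<bullet> (matrix_inv S *v (x - m))))"

definition mog :: "nat \<Rightarrow> (nat \<Rightarrow> real) \<Rightarrow> (nat \<Rightarrow> real^'n) \<Rightarrow> (nat \<Rightarrow> real^'n^'n) \<Rightarrow> real^'n \<Rightarrow> real" where
  "mog K w \<mu> S x = (\<Sum>k=1..K. w k * gauss (\<mu> k) (S k) x)"

definition mog_weight ::
  "nat \<Rightarrow> (nat \<Rightarrow> real) \<Rightarrow> (nat \<Rightarrow> real^'n) \<Rightarrow> (nat \<Rightarrow> real^'n^'n) \<Rightarrow> nat \<Rightarrow> real^'n \<Rightarrow> real" where
  "mog_weight K w \<mu> S k x =
     w k * gauss (\<mu> k) (S k) x / (\<Sum>l=1..K. w l * gauss (\<mu> l) (S l) x)"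

definition mog_params ::
  "nat \<Rightarrow> (nat \<Rightarrow> real) \<Rightarrow> (nat \<Rightarrow> real^'n) \<Rightarrow> (nat \<Rightarrow> real^'n^'n) \<Rightarrow> bool" where
  "mog_params K w \<mu> S \<longleftrightarrow>
     (\<forall>k\<in>{1..K}. 0 < w k \<and> sym_pos_def (S k)) \<and> (\<Sum>k=1..K. w k) = 1"

definition morse :: "(real^'n \<Rightarrow> real) \<Rightarrow> bool" where
  "morse f \<longleftrightarrow> (\<forall>x. grad f x = 0 \<longrightarrow> invertible (hessian f x))"

definition stable_equilibria :: "(real^'n \<Rightarrow> real) \<Rightarrow> (real^'n) set" where
  "stable_equilibria f = {x. grad f x = 0 \<and> pos_def (hessian f x)}"

definition gradient_field ::
  "(real^'n \<Rightarrow> real^'n^'n) \<Rightarrow> (real^'n \<Rightarrow> real) \<Rightarrow> real^'n \<Rightarrow> real^'n" where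
  "gradient_field R p x = matrix_inv (R x) *v grad (\<lambda>y. ln (p y)) x"

definition trajectory :: "(real^'n \<Rightarrow> real^'n) \<Rightarrow> (real \<Rightarrow> real^'n) \<Rightarrow> bool" where
  "trajectory F x \<longleftrightarrow> (\<forall>t. (x has_vector_derivative F (x t)) (at t))"

definition complete_field :: "(real^'n \<Rightarrow> real^'n) \<Rightarrow> bool" where
  "complete_field F \<longleftrightarrow> (\<forall>a. \<exists>x. trajectory F x \<and> x 0 = a)"

definition basin_cell :: "(real^'n \<Rightarrow> real^'n) \<Rightarrow> real^'n \<Rightarrow> (real^'n) set" where
  "basin_cell F x0 = closure {x 0 | x. trajectory F x \<and> (x \<longlongrightarrow> x0) at_top}"

lemma grad_eqI:
  assumes "GDERIV f x :> D" shows "grad f x = D"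
proof -
  have "E = D" if "GDERIV f x :> E" for E
  proof -
    have "(\<lambda>h. h \<bullet> E) = (\<lambda>h. h \<bullet> D)"
      using assms that has_derivative_unique unfolding gderiv_def by blast
    then have "h \<bullet> (E - D) = 0" for h by (metis inner_diff_right eq_iff_diff_eq_0)
    then show ?thesis by (metis inner_eq_zero_iff eq_iff_diff_eq_0)
  qed
  then show ?thesis unfolding grad_def using assms by blast
qed

lemma pos_def_invertible:
  fixes A :: "real^'n^'n" assumes "pos_def A" shows "invertible A"
proof -
  have "\<forall>v. A *v v = 0 \<longrightarrow> v = 0"
    using assms unfolding pos_def_def by (metis inner_zero_right less_irrefl)
  then show ?thesis by (simp add: invertible_left_inverse matrix_left_invertible_ker)
qed

lemma transpose_matrix_inv_sym:
  fixes A :: "real^'n^'n"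
  assumes i: "invertible A" and s: "transpose A = A"
  shows "transpose (matrix_inv A) = matrix_inv A"
proof -
  have inv: "A ** matrix_inv A = mat 1" "matrix_inv A ** A = mat 1"
    using i unfolding invertible_def matrix_inv_def by (metis (mono_tags, lifting) someI_ex)+
  then have "transpose (matrix_inv A) ** A = mat 1"
    using s by (metis matrix_transpose_mul transpose_mat)
  then show ?thesis using inv by (metis matrix_mul_assoc matrix_mul_lid matrix_mul_rid)
qed

lemma gauss_has_derivative:
  fixes A :: "real^'n^'n" assumes s: "transpose A = A"
  shows "((\<lambda>y. c * exp (- 1 / 2 * ((y - m) \<bullet> (A *v (y - m))))) has_derivative
   (\<lambda>h. c * exp (- 1 / 2 * ((x - m) \<bullet> (A *v (x - m)))) * - (h \<bullet> (A *v (x - m))))) (at x)"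
proof -
  have d: "((\<lambda>y. A *v (y - m)) has_derivative (\<lambda>h. A *v h)) (at x)"
    by (rule bounded_linear.has_derivative[OF matrix_vector_mul_bounded_linear])
       (auto intro!: derivative_eq_intros)
  have sw: "(x - m) \<bullet> (A *v h) = h \<bullet> (A *v (x - m))" for h
    by (metis dot_lmul_matrix inner_commute s vector_transpose_matrix)
  have e: "((\<lambda>y. y - m) has_derivative (\<lambda>h. h)) (at x)"
    by (auto intro!: derivative_eq_intros)
  have q: "((\<lambda>y. (y - m) \<bullet> (A *v (y - m))) has_derivative
            (\<lambda>h. 2 * (h \<bullet> (A *v (x - m))))) (at x)"
    using has_derivative_inner[OF e d] by (simp add: sw)
  show ?thesis
    by (rule has_derivative_eq_rhs, rule derivative_intros, rule has_derivative_exp,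
        rule has_derivative_mult_right, rule q) (simp add: fun_eq_iff)
qed

lemma gauss_pos: "sym_pos_def A \<Longrightarrow> 0 < gauss m A x"
  using pos_def_invertible[of A] unfolding gauss_def sym_pos_def_def
  by (simp add: invertible_det_nz)

lemma gderiv_ln_mog:
  assumes "mog_params K w \<mu> S"
  shows "GDERIV (\<lambda>y. ln (mog K w \<mu> S y)) x :>
           - (\<Sum>k=1..K. mog_weight K w \<mu> S k x *\<^sub>R (matrix_inv (S k) *v (x - \<mu> k)))"
proof -
  have spd: "sym_pos_def (S k)" and w: "0 < w k" if "k \<in> {1..K}" for k
    using assms that by (auto simp: mog_params_def)
  have "K \<noteq> 0" using assms by (auto simp: mog_params_def intro: ccontr)
  then have pos: "0 < mog K w \<mu> S x"
    unfolding mog_def by (intro sum_pos mult_pos_pos w gauss_pos spd) simp_all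
  have "((\<lambda>y. w k * gauss (\<mu> k) (S k) y) has_derivative
         (\<lambda>h. w k * (gauss (\<mu> k) (S k) x * - (h \<bullet> (matrix_inv (S k) *v (x - \<mu> k)))))) (at x)"
    if "k \<in> {1..K}" for k
    using spd[OF that] unfolding gauss_def sym_pos_def_def
    by (intro has_derivative_mult_right gauss_has_derivative transpose_matrix_inv_sym
        pos_def_invertible) auto
  then have "(mog K w \<mu> S has_derivative (\<lambda>h. \<Sum>k=1..K.
      w k * (gauss (\<mu> k) (S k) x * - (h \<bullet> (matrix_inv (S k) *v (x - \<mu> k)))))) (at x)"
    unfolding mog_def[abs_def] by (intro has_derivative_sum)
  then have "((\<lambda>y. ln (mog K w \<mu> S y)) has_derivative (\<lambda>h. (\<Sum>k=1..K.
      w k * (gauss (\<mu> k) (S k) x * - (h \<bullet> (matrix_inv (S k) *v (x - \<mu> k)))))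
      * inverse (mog K w \<mu> S x))) (at x)"
    using pos by (auto intro: has_derivative_ln)
  then show ?thesis
    unfolding gderiv_def
    by (rule has_derivative_eq_rhs)
       (simp add: fun_eq_iff inner_sum_right sum_distrib_left mog_weight_def
         divide_inverse sum_negf mult_ac mog_def)
qed

lemma grad_ln_mog:
  assumes "mog_params K w \<mu> S"
  shows "grad (\<lambda>y. ln (mog K w \<mu> S y)) x =
           - (\<Sum>k=1..K. mog_weight K w \<mu> S k x *\<^sub>R (matrix_inv (S k) *v (x - \<mu> k)))"
  by (rule grad_eqI[OF gderiv_ln_mog[OF assms]])

lemma gradient_field_mog:
  assumes "mog_params K w \<mu> S"
  shows "gradient_field R (mog K w \<mu> S) x =
     - (matrix_inv (R x) *v
          (\<Sum>k=1..K. mog_weight K w \<mu> S k x *\<^sub>R (matrix_inv (S k) *v (x - \<mu> k))))"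
  unfolding gradient_field_def grad_ln_mog[OF assms]
  by (simp add: linear_neg[OF matrix_vector_mul_linear])

end

theory Submission
  imports Defs
begin

text \<open>
The negative log density \<open>f\<close> is a strict Lyapunov function with bounded sublevel sets, so every
trajectory stays, in positive time, in a compact set on which the field is Lipschitz. The
equilibria form a bounded set and are isolated by the Morse condition, hence are finite in number,
and every trajectory converges to one of them. Basins of stable equilibria are open. The basin of an
unstable equilibrium \<open>a\<close> is negligible: with \<open>H\<close> the Hessian at \<open>a\<close>, the indefinite form
\<open>z \<bullet> H z\<close> of the difference \<open>z\<close> of two trajectories near \<open>a\<close> decreases exponentially once it is
negative, so the points whose trajectories stay near \<open>a\<close> form a set with chords outside an open
cone, i.e. part of a Lipschitz graph over a hyperplane; the flow carries this back in time. Thus the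
basins of the stable equilibria are disjoint open sets with negligible complement, and both claims
about their closures follow.
\<close>

section \<open>Quadratic forms and negligible sets\<close>

text \<open>The form attains a positive minimum on the compact unit sphere; homogeneity of degree
  two extends the bound to all vectors.\<close>

lemma pos_bounded_below:
  fixes T :: "'a::euclidean_space \<Rightarrow> 'a"
  assumes lin: "linear T" and pos: "\<And>v. v \<noteq> 0 \<Longrightarrow> 0 < v \<bullet> T v"
  obtains c where "0 < c" "\<And>v. c * (norm v)\<^sup>2 \<le> v \<bullet> T v"
proof -
  have "continuous_on (sphere 0 1) (\<lambda>v. v \<bullet> T v)"
    by (intro continuous_intros linear_continuous_on) (simp add: linear_conv_bounded_linear[symmetric] lin)
  then obtain u where u: "u \<in> sphere 0 1" "\<And>v. v \<in> sphere 0 1 \<Longrightarrow> u \<bullet> T u \<le> v \<bullet> T v"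
    using continuous_attains_inf[of "sphere (0::'a) 1" "\<lambda>v. v \<bullet> T v"] by (auto simp: sphere_eq_empty)
  have "u \<noteq> 0" using u(1) by auto
  show thesis
  proof (rule that)
    show "0 < u \<bullet> T u" by (rule pos) fact
    fix v :: 'a
    show "u \<bullet> T u * (norm v)\<^sup>2 \<le> v \<bullet> T v"
    proof (cases "v = 0")
      case True
      then show ?thesis using linear_0[OF lin] by simp
    next
      case False
      then have "u \<bullet> T u \<le> (v /\<^sub>R norm v) \<bullet> T (v /\<^sub>R norm v)" by (intro u(2)) simp
      also have "\<dots> = (v \<bullet> T v) / (norm v)\<^sup>2"
        using False by (simp add: linear_cmul[OF lin] power2_eq_square field_simps)
      finally show ?thesis using False by (simp add: field_simps)
    qed
  qed
qed

text \<open>Failure of positive definiteness only yields a nonpositive value of the form. Symmetry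
  and injectivity of \<open>A\<close> sharpen it to a negative one, as the cone argument at an
  unstable equilibrium requires.\<close>

lemma symmetric_negative_direction:
  fixes A :: "'a::real_inner \<Rightarrow> 'a"
  assumes lin: "linear A" and sym: "\<And>u v. A u \<bullet> v = u \<bullet> A v"
    and inj: "\<And>u. A u = 0 \<Longrightarrow> u = 0" and npd: "\<not> (\<forall>v. v \<noteq> 0 \<longrightarrow> 0 < v \<bullet> A v)"
  obtains v where "v \<bullet> A v < 0"
proof -
  obtain v where v: "v \<noteq> 0" "v \<bullet> A v \<le> 0" using npd by (auto simp: not_less)
  show thesis
  proof (cases "v \<bullet> A v < 0")
    case True
    then show ?thesis by (rule that)
  next
    case False
    \<comment> \<open>On an isotropic vector, moving against its image \<open>A v\<close> makes the form negative to first order.\<close>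
    define b where "b = \<bar>A v \<bullet> A (A v)\<bar> + 1"
    define n where "n = A v \<bullet> A v"
    have b: "0 < b" by (simp add: b_def)
    have n: "0 < n" using inj v(1) by (auto simp: n_def)
    have quad: "(v - t *\<^sub>R A v) \<bullet> A (v - t *\<^sub>R A v) = t\<^sup>2 * (A v \<bullet> A (A v)) - 2 * t * n" for t
      using v False sym[of v "A v"] unfolding linear_diff[OF lin] linear_cmul[OF lin]
      by (simp add: inner_diff n_def power2_eq_square algebra_simps)
    \<comment> \<open>The step length \<open>n / b\<close> minimises the majorant
      \<open>t\<^sup>2 * b - 2 * t * n\<close> of the form.\<close>
    have "(v - (n / b) *\<^sub>R A v) \<bullet> A (v - (n / b) *\<^sub>R A v)
        = (n / b)\<^sup>2 * (A v \<bullet> A (A v)) - 2 * (n / b) * n"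
      by (rule quad)
    also have "(n / b)\<^sup>2 * (A v \<bullet> A (A v)) \<le> (n / b)\<^sup>2 * b"
      by (intro mult_left_mono) (auto simp: b_def)
    also have "(n / b)\<^sup>2 * b = (n / b) * n" using b by (simp add: power2_eq_square)
    also have "(n / b) * n - 2 * (n / b) * n < 0" using b n by (simp add: field_simps)
    finally show ?thesis using that by auto
  qed
qed

text \<open>The map \<open>h\<close> is injective on \<open>W\<close> with a Lipschitz inverse, and
  Lipschitz maps of a Euclidean space into itself preserve negligibility. It serves both for a
  projection along a direction and for a time-\<open>n\<close> flow map.\<close>

lemma negligible_expanding:
  fixes W :: "'a::euclidean_space set" and h :: "'a \<Rightarrow> 'a"
  assumes neg: "negligible (h ` W)"
    and h: "\<And>x y. x \<in> W \<Longrightarrow> y \<in> W \<Longrightarrow> norm (y - x) \<le> B * norm (h y - h x)"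
  shows "negligible W"
proof -
  have inj: "inj_on h W" using h by (intro inj_onI) fastforce
  have "negligible (inv_into W h ` h ` W)"
  proof (rule negligible_locally_Lipschitz_image[OF order_refl neg])
    fix x assume "x \<in> h ` W"
    then show "\<exists>T B. open T \<and> x \<in> T \<and>
        (\<forall>y\<in>h ` W \<inter> T. norm (inv_into W h y - inv_into W h x) \<le> B * norm (y - x))"
      using h inj by (intro exI[of _ UNIV] exI[of _ B]) auto
  qed
  then show ?thesis using inj by simp
qed

text \<open>A set whose chords avoid a cone around \<open>v\<close> is a Lipschitz graph over the
  hyperplane orthogonal to \<open>v\<close>.\<close>

lemma negligible_cone_condition:
  fixes W :: "'a::euclidean_space set"
  assumes bl: "bounded_linear A" and v: "v \<bullet> A v < 0"
    and W: "\<And>x y. x \<in> W \<Longrightarrow> y \<in> W \<Longrightarrow> 0 \<le> (y - x) \<bullet> A (y - x)"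
  shows "negligible W"
proof -
  interpret A: bounded_linear A by fact
  have v0: "v \<noteq> 0" using v A.zero by auto
  define e where "e = v /\<^sub>R norm v"
  have e1: "norm e = 1" using v0 by (simp add: e_def)
  then have ee: "e \<bullet> e = 1" by (simp add: dot_square_norm)
  have "e \<bullet> A e = (v \<bullet> A v) / (norm v)\<^sup>2"
    using v0 by (simp add: e_def A.scaleR power2_eq_square field_simps)
  then have q: "e \<bullet> A e < 0" using v v0 by (simp add: divide_neg_pos)
  define q where "q = - (e \<bullet> A e)"
  obtain M where M: "0 < M" "\<And>u. norm (A u) \<le> norm u * M" using A.pos_bounded by blast
  define P where "P x = x - (x \<bullet> e) *\<^sub>R e" for x
  \<comment> \<open>With this slope \<open>q * L = 3 * M + q\<close>, so the negative term
    \<open>- q * a\<^sup>2\<close> outweighs the three others, each at most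
    \<open>a * norm u * M\<close>; \<open>1 \<le> L\<close> gives
    \<open>norm u \<le> a\<close>.\<close>
  define L where "L = 3 * M / q + 1"
  have q0: "0 < q" using q by (simp add: q_def)
  have L: "1 \<le> L" using M q0 by (simp add: L_def)
  have cone: "\<bar>z \<bullet> e\<bar> \<le> L * norm (P z)" if z: "0 \<le> z \<bullet> A z" for z
  proof (rule ccontr)
    define a where "a = \<bar>z \<bullet> e\<bar>"
    define u where "u = P z"
    assume "\<not> \<bar>z \<bullet> e\<bar> \<le> L * norm (P z)"
    then have g: "L * norm u < a" by (simp add: a_def u_def)
    have ua: "norm u \<le> a" using g L mult_right_mono[OF L norm_ge_zero[of u]] by simp
    have a0: "0 < a" using g L le_less_trans[of 0 "L * norm u" a] by simp
    have nAe: "norm (A e) \<le> M" and nAu: "norm (A u) \<le> norm u * M" using M(2) e1 by (metis mult_1, blast)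
    have z_eq: "z = (z \<bullet> e) *\<^sub>R e + u" by (simp add: u_def P_def)
    have "z \<bullet> A z = (z \<bullet> e)\<^sup>2 * (e \<bullet> A e) + (z \<bullet> e) * (e \<bullet> A u) + (z \<bullet> e) * (u \<bullet> A e) + u \<bullet> A u"
      by (subst (1 2) z_eq) (simp add: A.add A.scaleR inner_add power2_eq_square algebra_simps)
    also have "(z \<bullet> e)\<^sup>2 * (e \<bullet> A e) = - q * a\<^sup>2" by (simp add: q_def a_def)
    also have "(z \<bullet> e) * (e \<bullet> A u) \<le> a * (norm u * M)"
    proof -
      have "\<bar>e \<bullet> A u\<bar> \<le> norm u * M" using Cauchy_Schwarz_ineq2[of e "A u"] nAu e1 by simp
      then have "\<bar>(z \<bullet> e) * (e \<bullet> A u)\<bar> \<le> a * (norm u * M)"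
        unfolding abs_mult a_def by (intro mult_left_mono) auto
      then show ?thesis by linarith
    qed
    also have "(z \<bullet> e) * (u \<bullet> A e) \<le> a * (norm u * M)"
    proof -
      have "\<bar>u \<bullet> A e\<bar> \<le> norm u * norm (A e)" by (rule Cauchy_Schwarz_ineq2)
      also have "\<dots> \<le> norm u * M" using nAe by (intro mult_left_mono) auto
      finally have "\<bar>(z \<bullet> e) * (u \<bullet> A e)\<bar> \<le> a * (norm u * M)"
        unfolding abs_mult a_def by (intro mult_left_mono) auto
      then show ?thesis by linarith
    qed
    also have "u \<bullet> A u \<le> a * (norm u * M)"
    proof -
      have "u \<bullet> A u \<le> norm u * norm (A u)" by (rule norm_cauchy_schwarz)
      also have "\<dots> \<le> a * (norm u * M)" using ua nAu a0 by (intro mult_mono) auto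
      finally show ?thesis .
    qed
    finally have "z \<bullet> A z \<le> a * (3 * M * norm u - q * a)" by (simp add: algebra_simps power2_eq_square)
    moreover have "3 * M * norm u - q * a < 0"
    proof -
      have "3 * M * norm u \<le> q * (L * norm u)" using q0 by (simp add: L_def field_simps)
      also have "\<dots> < q * a" using g q0 by simp
      finally show ?thesis by simp
    qed
    ultimately have "z \<bullet> A z < 0" using a0 by (meson le_less_trans mult_pos_neg)
    then show False using z by simp
  qed
  have P_diff: "P (x - y) = P x - P y" for x y by (simp add: P_def algebra_simps)
  have norm_le: "norm (y - x) \<le> (L + 1) * norm (P y - P x)" if "x \<in> W" "y \<in> W" for x y
  proof -
    have "norm (y - x) = norm (((y - x) \<bullet> e) *\<^sub>R e + P (y - x))" by (simp add: P_def)
    also have "\<dots> \<le> \<bar>(y - x) \<bullet> e\<bar> + norm (P (y - x))"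
      using norm_triangle_ineq[of "((y - x) \<bullet> e) *\<^sub>R e"] by (simp add: e1)
    also have "\<dots> \<le> (L + 1) * norm (P (y - x))" using cone[OF W[OF that]] by (simp add: algebra_simps)
    finally show ?thesis by (simp add: P_diff)
  qed
  have "P ` W \<subseteq> {x. e \<bullet> x = 0}" by (auto simp: P_def inner_diff_right ee inner_commute)
  moreover have "e \<noteq> 0" using ee by auto
  ultimately have "negligible (P ` W)"
    using negligible_hyperplane[of e 0] negligible_subset by blast
  then show ?thesis by (rule negligible_expanding[OF _ norm_le])
qed

section \<open>Local estimates for C1 maps\<close>

text \<open>Strict differentiability: the mean value inequality is applied to
  \<open>g - g' a\<close>, whose derivative is small near \<open>a\<close>. Both points are free, as
  needed for differences of two trajectories.\<close>

lemma C1_strict: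
  fixes g :: "'a::euclidean_space \<Rightarrow> 'b::euclidean_space" and g' :: "'a \<Rightarrow> 'a \<Rightarrow>\<^sub>L 'b"
  assumes d: "\<And>x. (g has_derivative blinfun_apply (g' x)) (at x)"
    and c: "continuous_on UNIV g'" and e: "0 < e"
  obtains r where "0 < r"
    "\<And>x y. x \<in> ball a r \<Longrightarrow> y \<in> ball a r \<Longrightarrow> norm (g y - g x - g' a (y - x)) \<le> e * norm (y - x)"
proof -
  have "isCont g' a" using c by (simp add: continuous_on_eq_continuous_at)
  then obtain r where r: "0 < r" "\<And>x. dist x a < r \<Longrightarrow> dist (g' x) (g' a) < e"
    using e unfolding continuous_at_eps_delta by blast
  show thesis
  proof (rule that[OF r(1)])
    fix x y assume xy: "x \<in> ball a r" "y \<in> ball a r"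
    have "norm ((\<lambda>x. g x - g' a x) y - (\<lambda>x. g x - g' a x) x) \<le> e * norm (y - x)"
    proof (rule differentiable_bound[OF convex_ball[of a r] _ _ xy(2,1)])
      fix z assume z: "z \<in> ball a r"
      show "((\<lambda>x. g x - g' a x) has_derivative blinfun_apply (g' z - g' a)) (at z within ball a r)"
        by (auto intro!: derivative_eq_intros has_derivative_at_withinI[OF d] simp: blinfun.diff_left)
      show "onorm (blinfun_apply (g' z - g' a)) \<le> e"
        using r(2)[of z] z by (simp add: norm_blinfun.rep_eq[symmetric] dist_norm norm_minus_commute)
    qed
    then show "norm (g y - g x - g' a (y - x)) \<le> e * norm (y - x)"
      by (simp add: blinfun.diff_right algebra_simps)
  qed
qed

text \<open>The derivative is bounded on the compact ball, and convexity makes this bound a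
  Lipschitz constant.\<close>

lemma C1_lipschitz_on_cball:
  fixes g :: "'a::euclidean_space \<Rightarrow> 'b::real_normed_vector" and g' :: "'a \<Rightarrow> 'a \<Rightarrow>\<^sub>L 'b"
  assumes d: "\<And>x. (g has_derivative blinfun_apply (g' x)) (at x)"
    and c: "continuous_on UNIV g'"
  shows "\<exists>L. L-lipschitz_on (cball a r) g"
proof -
  have "bounded (g' ` cball a r)"
    by (intro compact_imp_bounded compact_continuous_image continuous_on_subset[OF c]) auto
  then obtain B where B: "0 < B" "\<And>x. x \<in> cball a r \<Longrightarrow> norm (g' x) \<le> B"
    by (auto simp: bounded_pos)
  have "B-lipschitz_on (cball a r) g"
  proof (rule lipschitz_onI)
    fix x y assume xy: "x \<in> cball a r" "y \<in> cball a r"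
    show "dist (g x) (g y) \<le> B * dist x y"
      unfolding dist_norm
      by (rule differentiable_bound[OF convex_cball[of a r] _ _ xy])
        (use B in \<open>auto intro: has_derivative_at_withinI[OF d] simp: norm_blinfun.rep_eq[symmetric]\<close>)
  qed (use B in simp)
  then show ?thesis ..
qed

section \<open>Gradient systems: the vector field and its equilibria\<close>

text \<open>Here \<open>f\<close> is the Lyapunov function, \<open>G\<close> and \<open>H\<close>
  are its gradient and Hessian, and \<open>N\<close> stands for the inverse metric. Bounded linear
  maps in place of matrices give the operator norm and its product estimates.\<close>

locale gradient_system =
  fixes f :: "real^'n \<Rightarrow> real"
    and F G :: "real^'n \<Rightarrow> real^'n"
    and H N :: "real^'n \<Rightarrow> (real^'n) \<Rightarrow>\<^sub>L (real^'n)"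
  assumes f_deriv: "GDERIV f x :> G x"
    and G_deriv: "(G has_derivative blinfun_apply (H x)) (at x)"
    and H_cont: "continuous_on UNIV H"
    and H_sym: "H x u \<bullet> v = u \<bullet> H x v"
    and H_inj: "G x = 0 \<Longrightarrow> H x u = 0 \<Longrightarrow> u = 0"
    and F_eq: "F x = - N x (G x)"
    and N_pos: "v \<noteq> 0 \<Longrightarrow> 0 < v \<bullet> N x v"
    and N_lipschitz: "\<exists>L. L-lipschitz_on (cball 0 r) N"
    and sublevel_bounded: "bounded {x. f x \<le> c}"
    and equilibria_bounded: "bounded {x. G x = 0}"
    and complete: "complete_field F"
begin

lemma f_cont: "continuous_on S f"
  using f_deriv unfolding gderiv_def
  by (blast intro: continuous_at_imp_continuous_on has_derivative_continuous)

lemma G_cont: "continuous_on S G"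
  using G_deriv by (blast intro: continuous_at_imp_continuous_on has_derivative_continuous)

lemma N_isCont: "isCont N x"
proof -
  obtain L where "L-lipschitz_on (cball 0 (norm x + 1)) N" using N_lipschitz by blast
  then have "continuous_on (ball 0 (norm x + 1)) N"
    by (metis lipschitz_on_continuous_on continuous_on_subset ball_subset_cball)
  then show ?thesis by (simp add: continuous_on_eq_continuous_at)
qed

text \<open>A product of two bounded Lipschitz maps is Lipschitz. Estimates on balls suffice because
  forward trajectories stay in bounded sublevel sets.\<close>

lemma F_lipschitz:
  obtains L where "0 \<le> L" "\<And>x y. x \<in> cball 0 r \<Longrightarrow> y \<in> cball 0 r \<Longrightarrow> norm (F x - F y) \<le> L * norm (x - y)"
proof -
  obtain L1 where L1: "L1-lipschitz_on (cball 0 r) N" using N_lipschitz by blast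
  obtain L2 where L2: "L2-lipschitz_on (cball 0 r) G"
    using C1_lipschitz_on_cball[OF G_deriv H_cont] by blast
  have "bounded (N ` cball 0 r)" "bounded (G ` cball 0 r)"
    by (intro compact_imp_bounded compact_continuous_image lipschitz_on_continuous_on[OF L1] G_cont
        compact_cball)+
  then obtain B C where B: "0 < B" "\<And>x. x \<in> cball 0 r \<Longrightarrow> norm (N x) \<le> B"
      and C: "0 < C" "\<And>x. x \<in> cball 0 r \<Longrightarrow> norm (G x) \<le> C"
    unfolding bounded_pos by (metis imageI)
  note L0 = lipschitz_on_nonneg[OF L1] lipschitz_on_nonneg[OF L2]
  show thesis
  proof (rule that)
    show "0 \<le> B * L2 + L1 * C" using B C L0 by simp
    fix x y :: "real^'n" assume xy: "x \<in> cball 0 r" "y \<in> cball 0 r"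
    have "F x - F y = N x (G y - G x) + (N y - N x) (G y)"
      by (simp add: F_eq blinfun.diff_left blinfun.diff_right)
    also have "norm \<dots> \<le> norm (N x) * norm (G y - G x) + norm (N y - N x) * norm (G y)"
      by (intro norm_triangle_mono norm_blinfun)
    also have "\<dots> \<le> B * (L2 * norm (x - y)) + (L1 * norm (x - y)) * C"
      using B C xy lipschitz_onD[OF L1 xy] lipschitz_onD[OF L2 xy] L0
      by (intro add_mono mult_mono) (auto simp: dist_norm norm_minus_commute)
    finally show "norm (F x - F y) \<le> (B * L2 + L1 * C) * norm (x - y)"
      by (simp add: algebra_simps)
  qed
qed

text \<open>At an equilibrium the linearisation of \<open>F\<close> is \<open>- N a\<close> composed
  with \<open>H a\<close>: the variation of \<open>N\<close> is multiplied by \<open>G\<close>,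
  which vanishes at \<open>a\<close>, so a Lipschitz bound on \<open>N\<close> controls that
  term.\<close>

lemma F_strict:
  assumes a: "G a = 0" and e: "0 < e"
  obtains r where "0 < r"
    "\<And>x y. x \<in> ball a r \<Longrightarrow> y \<in> ball a r \<Longrightarrow> norm (F y - F x + N a (H a (y - x))) \<le> e * norm (y - x)"
proof -
  obtain L where L: "L-lipschitz_on (cball 0 (norm a + 1)) N" using N_lipschitz by blast
  note L0 = lipschitz_on_nonneg[OF L]
  \<comment> \<open>The common tolerance \<open>k\<close> is \<open>e\<close> divided by the sum of
    the coefficients of the three error terms below; \<open>norm (N a) + 1\<close> bounds
    \<open>norm (N y)\<close>.\<close>
  define k where "k = e / (norm (N a) + 1 + norm (H a) + L)"
  have pos: "0 < norm (N a) + 1 + norm (H a) + L"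
    using L0 by (meson add_nonneg_nonneg add_nonneg_pos add_pos_nonneg norm_ge_zero zero_less_one)
  then have k: "0 < k" using e by (simp add: k_def)
  obtain r1 where r1: "0 < r1"
    "\<And>x y. x \<in> ball a r1 \<Longrightarrow> y \<in> ball a r1 \<Longrightarrow> norm (G y - G x - H a (y - x)) \<le> k * norm (y - x)"
    using C1_strict[OF G_deriv H_cont k] by blast
  obtain r2 where r2: "0 < r2" "\<And>x. dist x a < r2 \<Longrightarrow> dist (N x) (N a) < min k 1"
    using N_isCont[of a] k unfolding continuous_at_eps_delta by (metis min_less_iff_conj zero_less_one)
  have "isCont G a" using G_cont[of UNIV] by (simp add: continuous_on_eq_continuous_at)
  then obtain r3 where r3: "0 < r3" "\<And>x. dist x a < r3 \<Longrightarrow> dist (G x) (G a) < k"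
    using k unfolding continuous_at_eps_delta by blast
  show thesis
  proof (rule that)
    \<comment> \<open>The entry 1 keeps both points in the ball on which \<open>L\<close> is a
      Lipschitz constant.\<close>
    show "0 < Min {1, r1, r2, r3}" using r1 r2 r3 by simp
    fix x y assume "x \<in> ball a (Min {1, r1, r2, r3})" "y \<in> ball a (Min {1, r1, r2, r3})"
    then have xy: "x \<in> ball a r1" "y \<in> ball a r1" "dist x a < r2" "dist y a < r2" "dist x a < r3"
        "dist x a < 1" "dist y a < 1"
      by (auto simp: dist_commute)
    have "x \<in> cball 0 (norm a + 1)" "y \<in> cball 0 (norm a + 1)"
      using xy(6,7) norm_triangle_sub[of x a] norm_triangle_sub[of y a] by (auto simp: dist_norm)
    then have NL: "norm (N y - N x) \<le> L * norm (y - x)"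
      using lipschitz_onD[OF L] by (metis dist_norm)
    have Ny: "norm (N y - N a) \<le> k" "norm (N y - N a) \<le> 1"
      using r2(2)[OF xy(4)] by (auto simp: dist_norm)
    have Ny1: "norm (N y) \<le> norm (N a) + 1" using Ny(2) norm_triangle_sub[of "N y" "N a"] by simp
    have Gx: "norm (G x) \<le> k" using r3(2)[OF xy(5)] by (simp add: a)
    have "F y - F x + N a (H a (y - x))
        = - (N y (G y - G x - H a (y - x)) + ((N y - N a) (H a (y - x)) + (N y - N x) (G x)))"
      by (simp add: F_eq blinfun.diff_left blinfun.diff_right)
    also have "norm \<dots> \<le> norm (N y) * norm (G y - G x - H a (y - x))
        + (norm (N y - N a) * norm (H a (y - x)) + norm (N y - N x) * norm (G x))"
      unfolding norm_minus_cancel by (intro norm_triangle_mono norm_blinfun)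
    also have "\<dots> \<le> (norm (N a) + 1) * (k * norm (y - x))
        + (k * (norm (H a) * norm (y - x)) + L * norm (y - x) * k)"
      using Ny Ny1 Gx NL r1(2)[OF xy(1,2)] k L0
      by (intro add_mono mult_mono norm_blinfun) auto
    also have "\<dots> = k * (norm (N a) + 1 + norm (H a) + L) * norm (y - x)"
      by (simp add: algebra_simps)
    also have "\<dots> = e * norm (y - x)" using pos by (simp add: k_def)
    finally show "norm (F y - F x + N a (H a (y - x))) \<le> e * norm (y - x)" .
  qed
qed

text \<open>The injective Hessian stretches vectors by at least \<open>m\<close>, and near
  \<open>a\<close> the remainder, of relative size \<open>m / 2\<close>, cannot cancel that.\<close>

lemma equilibrium_isolated:
  assumes a: "G a = 0"
  obtains r where "0 < r" "\<And>x. x \<in> ball a r \<Longrightarrow> G x = 0 \<Longrightarrow> x = a"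
proof -
  have "inj (blinfun_apply (H a))"
    using H_inj[OF a] by (simp add: linear_injective_0 blinfun.bounded_linear_right bounded_linear.linear)
  then obtain m where m: "0 < m" "\<And>u. m * norm u \<le> norm (H a u)"
    using linear_inj_bounded_below_pos
    by (metis blinfun.bounded_linear_right bounded_linear.linear)
  obtain r where r: "0 < r" "\<And>x y. x \<in> ball a r \<Longrightarrow> y \<in> ball a r \<Longrightarrow>
      norm (G y - G x - H a (y - x)) \<le> m / 2 * norm (y - x)"
    using C1_strict[OF G_deriv H_cont] m(1) half_gt_zero by blast
  show thesis
  proof (rule that[OF r(1)])
    fix x assume x: "x \<in> ball a r" "G x = 0"
    have "m * norm (x - a) \<le> m / 2 * norm (x - a)"
      using r(2)[of a x] x r(1) m(2)[of "x - a"] by (simp add: a)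
    then show "x = a" using m(1) by (simp add: field_simps)
  qed
qed

text \<open>Infinitely many equilibria in a bounded set would accumulate at a point that is an
  equilibrium by closedness, contradicting isolation.\<close>

lemma finite_equilibria: "finite {x. G x = 0}"
proof (rule ccontr)
  assume "infinite {x. G x = 0}"
  then obtain a where a: "a islimpt {x. G x = 0}"
    using bounded_infinite_imp_islimpt[OF subset_refl equilibria_bounded] by blast
  have "closed {x. G x = 0}"
    using continuous_closed_vimage[of "{0}" G] G_cont[of UNIV]
    by (simp add: continuous_on_eq_continuous_at vimage_def)
  then have "G a = 0" using a by (auto simp: closed_limpt)
  then obtain r where "0 < r" "\<And>x. x \<in> ball a r \<Longrightarrow> G x = 0 \<Longrightarrow> x = a"
    using equilibrium_isolated by blast
  then show False using a unfolding islimpt_approachable by (metis dist_commute mem_Collect_eq mem_ball)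
qed

section \<open>Trajectories, energy decay and dependence on the initial point\<close>

lemma trajectory_shift:
  assumes "trajectory F x" shows "trajectory F (\<lambda>t. x (t + s))"
  unfolding trajectory_def
proof
  fix t
  have "((\<lambda>t. t + s) has_vector_derivative 1) (at t)" by (auto intro!: derivative_eq_intros)
  moreover have "(x has_vector_derivative F (x (t + s))) (at (t + s))" using assms by (simp add: trajectory_def)
  ultimately show "((\<lambda>t. x (t + s)) has_vector_derivative F (x (t + s))) (at t)"
    using vector_diff_chain_at[of "\<lambda>t. t + s" 1 t x] by (simp add: o_def)
qed

lemma trajectory_cont: "trajectory F x \<Longrightarrow> continuous_on S x"
  unfolding trajectory_def
  by (blast intro: continuous_at_imp_continuous_on has_vector_derivative_continuous)

lemma trajectory_f_deriv:
  assumes "trajectory F x"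
  shows "((\<lambda>t. f (x t)) has_real_derivative - (G (x t) \<bullet> N (x t) (G (x t)))) (at t)"
proof -
  have "((\<lambda>t. f (x t)) has_derivative (\<lambda>h. (h *\<^sub>R F (x t)) \<bullet> G (x t))) (at t)"
    by (rule has_derivative_compose)
      (use assms f_deriv[of "x t"] in \<open>auto simp: trajectory_def has_vector_derivative_def gderiv_def\<close>)
  then show ?thesis
    unfolding has_field_derivative_def
    by (rule has_derivative_eq_rhs) (simp add: F_eq fun_eq_iff inner_commute)
qed

lemma N_nonneg: "0 \<le> v \<bullet> N x v"
  using N_pos[of v x] by (cases "v = 0") auto

lemma trajectory_f_decreasing:
  assumes "trajectory F x" "s \<le> t" shows "f (x t) \<le> f (x s)"
  by (rule DERIV_nonpos_imp_nonincreasing[OF assms(2)])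
    (use trajectory_f_deriv[OF assms(1)] N_nonneg in \<open>meson neg_le_0_iff_le\<close>)

text \<open>The derivative at time 0 is negative, so \<open>f\<close> drops at once, and
  monotonicity preserves the drop until time 1.\<close>

lemma trajectory_f_strict:
  assumes x: "trajectory F x" and G: "G (x 0) \<noteq> 0" shows "f (x 1) < f (x 0)"
proof -
  have "- (G (x 0) \<bullet> N (x 0) (G (x 0))) < 0" using N_pos[OF G] by simp
  then obtain d where d: "0 < d" "\<And>h. 0 < h \<Longrightarrow> h < d \<Longrightarrow> f (x (0 + h)) < f (x 0)"
    using DERIV_neg_dec_right[OF trajectory_f_deriv[OF x]] by blast
  define h where "h = min 1 (d / 2)"
  have "f (x h) < f (x 0)" using d(2)[of h] d(1) by (auto simp: h_def)
  moreover have "f (x 1) \<le> f (x h)" by (rule trajectory_f_decreasing[OF x]) (simp add: h_def)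
  ultimately show ?thesis by simp
qed

lemma sublevel_cball:
  obtains r where "0 < r" "{x. f x \<le> c} \<subseteq> cball 0 r"
  using sublevel_bounded[of c] by (force simp: bounded_pos)

lemma trajectory_sublevel:
  assumes "trajectory F x" "f (x s) \<le> c" "s \<le> t" "{x. f x \<le> c} \<subseteq> cball 0 r" shows "x t \<in> cball 0 r"
  using trajectory_f_decreasing[OF assms(1,3)] assms(2) by (intro subsetD[OF assms(4)]) simp

lemma trajectory_dist_deriv:
  assumes "trajectory F x" "trajectory F y"
  shows "((\<lambda>t. (norm (x t - y t))\<^sup>2) has_real_derivative 2 * ((x t - y t) \<bullet> (F (x t) - F (y t)))) (at t)"
proof -
  have "((\<lambda>t. x t - y t) has_derivative (\<lambda>h. h *\<^sub>R (F (x t) - F (y t)))) (at t)"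
    using has_vector_derivative_diff assms unfolding trajectory_def has_vector_derivative_def by blast
  from has_derivative_inner[OF this this] show ?thesis
    unfolding has_field_derivative_def power2_norm_eq_inner
    by (rule has_derivative_eq_rhs) (simp add: fun_eq_iff inner_commute)
qed

text \<open>Gronwall's inequality in both time directions, by monotonicity of
  \<open>|x - y|\<^sup>2 e\<^bsup>-2Lt\<^esup>\<close> and \<open>|x - y|\<^sup>2 e\<^bsup>2Lt\<^esup>\<close>.\<close>

lemma trajectory_gronwall:
  assumes x: "trajectory F x" and y: "trajectory F y" and T: "0 \<le> T"
    and L: "\<And>u v. u \<in> cball 0 r \<Longrightarrow> v \<in> cball 0 r \<Longrightarrow> norm (F u - F v) \<le> L * norm (u - v)"
    and r: "\<And>t. 0 \<le> t \<Longrightarrow> t \<le> T \<Longrightarrow> x t \<in> cball 0 r \<and> y t \<in> cball 0 r"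
  shows "norm (x T - y T) \<le> exp (L * T) * norm (x 0 - y 0)"
    and "norm (x 0 - y 0) \<le> exp (L * T) * norm (x T - y T)"
proof -
  define d where "d t = (norm (x t - y t))\<^sup>2" for t
  define d' where "d' t = 2 * ((x t - y t) \<bullet> (F (x t) - F (y t)))" for t
  have der: "(d has_real_derivative d' t) (at t)" for t
    unfolding d_def[abs_def] d'_def by (rule trajectory_dist_deriv[OF x y])
  have d': "\<bar>d' t\<bar> \<le> 2 * L * d t" if "0 \<le> t" "t \<le> T" for t
  proof -
    have "\<bar>(x t - y t) \<bullet> (F (x t) - F (y t))\<bar> \<le> norm (x t - y t) * norm (F (x t) - F (y t))"
      by (rule Cauchy_Schwarz_ineq2)
    also have "\<dots> \<le> norm (x t - y t) * (L * norm (x t - y t))"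
      using L r[OF that] by (intro mult_left_mono) auto
    finally show ?thesis by (simp add: d'_def d_def abs_mult power2_eq_square algebra_simps)
  qed
  have dexp: "((\<lambda>t. d t * exp (c * t)) has_real_derivative (d' t + c * d t) * exp (c * t)) (at t)" for t c
    by (auto intro!: derivative_eq_intros der simp: algebra_simps)
  have "d T * exp (- 2 * L * T) \<le> d 0 * exp (- 2 * L * 0)"
  proof (rule DERIV_nonpos_imp_nonincreasing[OF T])
    fix t assume "0 \<le> t" "t \<le> T"
    then have "(d' t + - 2 * L * d t) * exp (- 2 * L * t) \<le> 0"
      using d'[of t] by (intro mult_nonpos_nonneg) auto
    then show "\<exists>z. ((\<lambda>t. d t * exp (- 2 * L * t)) has_real_derivative z) (at t) \<and> z \<le> 0"
      using dexp[of "- 2 * L" t] by blast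
  qed
  then have "d T \<le> d 0 * (exp (L * T))\<^sup>2"
    by (simp add: exp_minus field_simps exp_double[symmetric] mult.assoc)
  then have "(norm (x T - y T))\<^sup>2 \<le> (exp (L * T) * norm (x 0 - y 0))\<^sup>2"
    by (simp add: d_def power_mult_distrib mult.commute)
  then show "norm (x T - y T) \<le> exp (L * T) * norm (x 0 - y 0)"
    by (rule power2_le_imp_le) simp
  have "d 0 * exp (2 * L * 0) \<le> d T * exp (2 * L * T)"
  proof (rule DERIV_nonneg_imp_nondecreasing[OF T])
    fix t assume "0 \<le> t" "t \<le> T"
    then have "0 \<le> (d' t + 2 * L * d t) * exp (2 * L * t)"
      using d'[of t] by (intro mult_nonneg_nonneg) auto
    then show "\<exists>z. ((\<lambda>t. d t * exp (2 * L * t)) has_real_derivative z) (at t) \<and> 0 \<le> z"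
      using dexp[of "2 * L" t] by blast
  qed
  then have "d 0 \<le> d T * (exp (L * T))\<^sup>2"
    by (simp add: field_simps exp_double[symmetric] mult.assoc)
  then have "(norm (x 0 - y 0))\<^sup>2 \<le> (exp (L * T) * norm (x T - y T))\<^sup>2"
    by (simp add: d_def power_mult_distrib mult.commute)
  then show "norm (x 0 - y 0) \<le> exp (L * T) * norm (x T - y T)"
    by (rule power2_le_imp_le) simp
qed

text \<open>No exit-time argument is needed for the continuity of the flow: in positive time, all
  trajectories starting in a sublevel set of \<open>f\<close> stay in it.\<close>

lemma flow_lipschitz:
  assumes T: "0 \<le> T"
  obtains B where "0 < B"
    "\<And>x y. trajectory F x \<Longrightarrow> trajectory F y \<Longrightarrow> f (x 0) \<le> c \<Longrightarrow> f (y 0) \<le> c \<Longrightarrow>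
      norm (x T - y T) \<le> B * norm (x 0 - y 0) \<and> norm (x 0 - y 0) \<le> B * norm (x T - y T)"
proof -
  obtain r where r: "{x. f x \<le> c} \<subseteq> cball 0 r" using sublevel_cball by blast
  obtain L where L: "\<And>u v. u \<in> cball 0 r \<Longrightarrow> v \<in> cball 0 r \<Longrightarrow> norm (F u - F v) \<le> L * norm (u - v)"
    using F_lipschitz by blast
  show thesis
  proof (rule that)
    show "0 < exp (L * T)" by simp
    fix x y assume "trajectory F x" "trajectory F y" "f (x 0) \<le> c" "f (y 0) \<le> c"
    then show "norm (x T - y T) \<le> exp (L * T) * norm (x 0 - y 0)
        \<and> norm (x 0 - y 0) \<le> exp (L * T) * norm (x T - y T)"
      using trajectory_sublevel r by (intro conjI trajectory_gronwall[OF _ _ T L]) blast+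
  qed
qed

lemma trajectory_exists: obtains x where "trajectory F x" "x 0 = a"
  using complete unfolding complete_field_def by blast

text \<open>Completeness supplies existence only; forward uniqueness is the flow estimate for equal
  initial points.\<close>

lemma trajectory_unique:
  assumes x: "trajectory F x" and y: "trajectory F y" and "x 0 = y 0" "0 \<le> t"
  shows "x t = y t"
proof -
  obtain B where "norm (x t - y t) \<le> B * norm (x 0 - y 0)"
    using flow_lipschitz[OF \<open>0 \<le> t\<close>, of "f (x 0)"] x y \<open>x 0 = y 0\<close> by (metis order_refl)
  then show ?thesis using \<open>x 0 = y 0\<close> by simp
qed

section \<open>Convergence to equilibria\<close>

text \<open>A form of LaSalle's invariance principle: \<open>f\<close> decreases to
  \<open>f e\<close> along the trajectory, and by continuity of the time-one flow the trajectory
  from \<open>e\<close> cannot fall below \<open>f e\<close> at time 1, so \<open>e\<close> is an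
  equilibrium.\<close>

lemma limit_point_equilibrium:
  fixes s :: "nat \<Rightarrow> real"
  assumes x: "trajectory F x" and s: "filterlim s at_top sequentially" and e: "(\<lambda>n. x (s n)) \<longlonglongrightarrow> e"
  shows "G e = 0"
proof (rule ccontr)
  assume nz: "G e \<noteq> 0"
  obtain y where y: "trajectory F y" "y 0 = e" by (rule trajectory_exists)
  have fcont: "isCont f z" for z using f_cont[of UNIV] by (simp add: continuous_on_eq_continuous_at)
  have fs: "(\<lambda>n. f (x (s n))) \<longlonglongrightarrow> f e" by (rule isCont_tendsto_compose[OF fcont e])
  have ge: "f e \<le> f (x t)" for t
  proof (rule tendsto_upperbound[OF fs _ sequentially_bot])
    have "\<forall>\<^sub>F n in sequentially. t \<le> s n" using s by (simp add: filterlim_at_top)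
    then show "\<forall>\<^sub>F n in sequentially. f (x (s n)) \<le> f (x t)"
      by eventually_elim (rule trajectory_f_decreasing[OF x])
  qed
  \<comment> \<open>The level \<open>f e + 1\<close> leaves room for \<open>e\<close> and for all
    late points \<open>x (s n)\<close>, so one Lipschitz constant serves them all.\<close>
  obtain B where B: "0 < B" "\<And>x y. trajectory F x \<Longrightarrow> trajectory F y \<Longrightarrow> f (x 0) \<le> f e + 1 \<Longrightarrow>
      f (y 0) \<le> f e + 1 \<Longrightarrow> norm (x 1 - y 1) \<le> B * norm (x 0 - y 0)"
    using flow_lipschitz[of 1 "f e + 1"] by (metis zero_le_one)
  have "\<forall>\<^sub>F n in sequentially. f (x (s n)) < f e + 1" by (rule order_tendstoD[OF fs]) simp
  then have le: "\<forall>\<^sub>F n in sequentially. norm (x (s n + 1) - y 1) \<le> norm (x (s n) - e) * B"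
  proof eventually_elim
    case (elim n)
    then show ?case
      using B(2)[OF trajectory_shift[OF x, of "s n"] y(1)] y(2) by (simp add: add.commute mult.commute)
  qed
  have "(\<lambda>n. x (s n) - e) \<longlonglongrightarrow> 0" using e by (simp add: LIM_zero)
  then have "(\<lambda>n. x (s n + 1) - y 1) \<longlonglongrightarrow> 0" by (rule tendsto_0_le[OF _ le])
  then have "(\<lambda>n. x (s n + 1)) \<longlonglongrightarrow> y 1" by (simp add: LIM_zero_iff)
  then have "(\<lambda>n. f (x (s n + 1))) \<longlonglongrightarrow> f (y 1)" by (rule isCont_tendsto_compose[OF fcont])
  then have "f e \<le> f (y 1)" by (rule tendsto_lowerbound) (use ge in auto)
  then show False using trajectory_f_strict[OF y(1)] y(2) nz by simp
qed

text \<open>The bound on \<open>s\<close> keeps the times nonnegative, hence the points in a compact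
  ball, and also sends them to infinity.\<close>

lemma trajectory_limit_point:
  fixes s :: "nat \<Rightarrow> real"
  assumes x: "trajectory F x" and s: "\<And>n. real n \<le> s n"
  obtains e r where "G e = 0" "strict_mono r" "(\<lambda>n. x (s (r n))) \<longlonglongrightarrow> e"
proof -
  obtain R where R: "{z. f z \<le> f (x 0)} \<subseteq> cball 0 R" by (rule sublevel_cball)
  have "x (s n) \<in> cball 0 R" for n
    by (rule trajectory_sublevel[OF x order_refl _ R]) (use s[of n] in linarith)
  then obtain e r where er: "strict_mono r" "((\<lambda>n. x (s n)) \<circ> r) \<longlonglongrightarrow> e"
    using compact_cball[of 0 R] unfolding compact_def by metis
  have "filterlim s at_top sequentially"
    by (rule filterlim_at_top_mono[OF filterlim_real_sequentially]) (simp add: s)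
  then have "filterlim (\<lambda>n. s (r n)) at_top sequentially"
    by (rule filterlim_compose[OF _ filterlim_subseq[OF er(1)]])
  then have "G e = 0" using limit_point_equilibrium[OF x] er(2) by (simp add: o_def)
  then show thesis using that er by (simp add: o_def)
qed

text \<open>If a limit point \<open>e\<close> were not the limit, the trajectory would cross a small sphere around
  \<open>e\<close> at arbitrarily large times, producing an equilibrium on that sphere.\<close>

lemma trajectory_converges:
  assumes x: "trajectory F x"
  obtains e where "G e = 0" "(x \<longlongrightarrow> e) at_top"
proof -
  obtain e r where e: "G e = 0" and r: "strict_mono r" "(\<lambda>n. x (real (r n))) \<longlonglongrightarrow> e"
    using trajectory_limit_point[OF x, of real] by auto
  obtain d where d: "0 < d" "\<And>z. z \<in> ball e d \<Longrightarrow> G z = 0 \<Longrightarrow> z = e"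
    using equilibrium_isolated[OF e] by blast
  have "(x \<longlongrightarrow> e) at_top"
  proof (rule ccontr)
    assume "\<not> (x \<longlongrightarrow> e) at_top"
    then obtain k where k: "0 < k" "\<And>T. \<exists>t\<ge>T. k \<le> dist (x t) e"
      unfolding tendsto_iff eventually_at_top_linorder by (auto simp: not_less)
    \<comment> \<open>Since \<open>m < d\<close>, the sphere of radius \<open>m\<close> carries no
      equilibrium; since \<open>m \<le> k\<close>, the trajectory must cross it between a close
      return to \<open>e\<close> and a later excursion.\<close>
    define m where "m = min k (d / 2)"
    have m: "0 < m" "m \<le> k" "m < d" using k(1) d(1) by (auto simp: m_def)
    have "\<exists>t\<ge>real n. dist (x t) e = m" for n
    proof -
      have "\<forall>\<^sub>F i in sequentially. dist (x (real (r i))) e < m"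
        using r(2) m(1) by (simp add: tendsto_iff)
      then obtain i where i: "n \<le> i" "dist (x (real (r i))) e < m"
        unfolding eventually_sequentially by (metis nle_le order_refl)
      have ri: "real n \<le> real (r i)" using seq_suble[OF r(1), of i] i(1) by simp
      obtain t where t: "t \<ge> real (r i)" "k \<le> dist (x t) e" using k(2) by blast
      have "\<exists>u. real (r i) \<le> u \<and> u \<le> t \<and> dist (x u) e = m"
        using i(2) t m(2) by (intro IVT') (auto intro!: continuous_intros trajectory_cont[OF x])
      then show ?thesis using ri by (metis order_trans)
    qed
    then obtain s where s: "\<And>n. real n \<le> s n" "\<And>n. dist (x (s n)) e = m" by metis
    obtain e' r' where e': "G e' = 0" and r': "strict_mono r'" "(\<lambda>n. x (s (r' n))) \<longlonglongrightarrow> e'"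
      using trajectory_limit_point[OF x s(1)] by blast
    have "(\<lambda>n. dist (x (s (r' n))) e) \<longlonglongrightarrow> dist e' e" by (intro tendsto_intros r')
    then have "dist e' e = m" by (simp add: s(2) LIMSEQ_const_iff)
    then show False using d(2)[of e'] e' m by (auto simp: dist_commute)
  qed
  then show thesis using that e by blast
qed

section \<open>Basins of attraction and stable equilibria\<close>

text \<open>The basin cell before taking the closure; at this level disjointness is exact.\<close>

definition basin :: "real^'n \<Rightarrow> (real^'n) set" where
  "basin a = {x 0 |x. trajectory F x \<and> (x \<longlongrightarrow> a) at_top}"

text \<open>By uniqueness, membership can be tested on any trajectory through the point.\<close>

lemma basin_iff:
  assumes x: "trajectory F x"
  shows "x 0 \<in> basin a \<longleftrightarrow> (x \<longlongrightarrow> a) at_top"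
proof
  assume "x 0 \<in> basin a"
  then obtain y where y: "trajectory F y" "y 0 = x 0" "(y \<longlongrightarrow> a) at_top" by (auto simp: basin_def)
  have "\<forall>\<^sub>F t in at_top. y t = x t"
    using eventually_ge_at_top[of 0] by eventually_elim (rule trajectory_unique[OF y(1) x y(2)])
  then show "(x \<longlongrightarrow> a) at_top" using y(3) tendsto_cong by metis
qed (use x in \<open>auto simp: basin_def\<close>)

lemma basin_disjoint: "a \<noteq> b \<Longrightarrow> basin a \<inter> basin b = {}"
proof (rule ccontr)
  assume ab: "a \<noteq> b" and "basin a \<inter> basin b \<noteq> {}"
  then obtain z where "z \<in> basin a" "z \<in> basin b" by blast
  then obtain x where "trajectory F x" "(x \<longlongrightarrow> a) at_top" "(x \<longlongrightarrow> b) at_top"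
    using trajectory_exists[of z] basin_iff by metis
  then show False using ab tendsto_unique[OF trivial_limit_at_top_linorder] by blast
qed

lemma basins_cover: "(\<Union>a\<in>{a. G a = 0}. basin a) = UNIV"
proof -
  have "z \<in> (\<Union>a\<in>{a. G a = 0}. basin a)" for z
  proof -
    obtain x where x: "trajectory F x" "x 0 = z" by (rule trajectory_exists)
    obtain e where "G e = 0" "(x \<longlongrightarrow> e) at_top" using trajectory_converges[OF x(1)] by blast
    then show ?thesis using x basin_iff by blast
  qed
  then show ?thesis by blast
qed

lemma basin_shift:
  assumes x: "trajectory F x" and xT: "x T \<in> basin a" shows "x 0 \<in> basin a"
proof -
  have "((\<lambda>t. x (t + T)) \<longlongrightarrow> a) at_top"
    using basin_iff[OF trajectory_shift[OF x, of T]] xT by simp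
  moreover have "filterlim (\<lambda>t. - T + t) at_top at_top"
    by (rule filterlim_tendsto_add_at_top[OF tendsto_const filterlim_ident])
  ultimately have "((\<lambda>t. x (- T + t + T)) \<longlongrightarrow> a) at_top" by (rule filterlim_compose)
  then show ?thesis using basin_iff[OF x] by simp
qed

definition stable :: "(real^'n) set" where
  "stable = {a. G a = 0 \<and> (\<forall>v. v \<noteq> 0 \<longrightarrow> 0 < v \<bullet> H a v)}"

text \<open>Definiteness of the Hessian makes \<open>G\<close> point away from \<open>a\<close> on a
  small ball; the mean value theorem along the segment from \<open>a\<close> to \<open>x\<close>
  then gives the strict increase.\<close>

lemma stable_strict_min:
  assumes a: "a \<in> stable"
  obtains r where "0 < r" "\<And>x. x \<in> cball a r \<Longrightarrow> x \<noteq> a \<Longrightarrow> f a < f x \<and> G x \<noteq> 0"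
proof -
  have "linear (H a)" by (simp add: blinfun.bounded_linear_right bounded_linear.linear)
  then obtain c where c: "0 < c" "\<And>v. c * (norm v)\<^sup>2 \<le> v \<bullet> H a v"
    using pos_bounded_below a unfolding stable_def by blast
  obtain r where r: "0 < r" "\<And>x y. x \<in> ball a r \<Longrightarrow> y \<in> ball a r \<Longrightarrow>
      norm (G y - G x - H a (y - x)) \<le> c / 2 * norm (y - x)"
    using C1_strict[OF G_deriv H_cont] c(1) half_gt_zero by blast
  have pos: "0 < (x - a) \<bullet> G x" if x: "x \<in> ball a r" "x \<noteq> a" for x
  proof -
    have "norm (G x - H a (x - a)) \<le> c / 2 * norm (x - a)"
      using r(2)[of a x] x(1) r(1) a by (simp add: stable_def)
    then have "norm (x - a) * norm (G x - H a (x - a)) \<le> norm (x - a) * (c / 2 * norm (x - a))"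
      by (intro mult_left_mono) auto
    then have "\<bar>(x - a) \<bullet> (G x - H a (x - a))\<bar> \<le> c / 2 * (norm (x - a))\<^sup>2"
      using Cauchy_Schwarz_ineq2[of "x - a" "G x - H a (x - a)"] by (simp add: power2_eq_square algebra_simps)
    moreover have "0 < c / 2 * (norm (x - a))\<^sup>2" using c(1) x(2) by simp
    ultimately show ?thesis
      using c(2)[of "x - a"] unfolding inner_diff_right[of "x - a" "G x"] by linarith
  qed
  show thesis
  \<comment> \<open>Halving the radius places the closed ball inside the open ball of the
    estimate.\<close>
  proof (rule that[of "r / 2"])
    fix x assume x: "x \<in> cball a (r / 2)" "x \<noteq> a"
    define u where "u = x - a"
    have "((\<lambda>t. f (a + t *\<^sub>R u)) has_real_derivative u \<bullet> G (a + t *\<^sub>R u)) (at t)" for t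
    proof -
      have "((\<lambda>t. a + t *\<^sub>R u) has_derivative (\<lambda>h. h *\<^sub>R u)) (at t)" by (auto intro!: derivative_eq_intros)
      from has_derivative_compose[OF this f_deriv[unfolded gderiv_def]]
      show ?thesis unfolding has_field_derivative_def
        by (rule has_derivative_eq_rhs) (simp add: fun_eq_iff)
    qed
    then obtain t where t: "0 < t" "t < 1" "f (a + 1 *\<^sub>R u) - f (a + 0 *\<^sub>R u) = (1 - 0) * (u \<bullet> G (a + t *\<^sub>R u))"
      using MVT2[of 0 1 "\<lambda>t. f (a + t *\<^sub>R u)" "\<lambda>t. u \<bullet> G (a + t *\<^sub>R u)"] by auto
    have "norm u \<le> r / 2" using x(1) by (simp add: u_def dist_norm norm_minus_commute)
    moreover have "norm (t *\<^sub>R u) \<le> norm u" using t by (simp add: mult_left_le_one_le)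
    ultimately have "norm (t *\<^sub>R u) < r" using r(1) by linarith
    then have "a + t *\<^sub>R u \<in> ball a r" by (simp add: dist_norm)
    then have "0 < t * (u \<bullet> G (a + t *\<^sub>R u))" using pos[of "a + t *\<^sub>R u"] t x(2) by (simp add: u_def)
    then have "0 < u \<bullet> G (a + t *\<^sub>R u)" using t(1) by (simp add: zero_less_mult_iff)
    then have "f a < f x" using t(3) by (simp add: u_def)
    moreover have "G x \<noteq> 0" using pos[of x] x r(1) by auto
    ultimately show "f a < f x \<and> G x \<noteq> 0" by simp
  qed (use r in simp)
qed

text \<open>Barrier argument: starting inside the sphere below the minimum of \<open>f\<close> on
  it, a trajectory can never reach the sphere. Its limit is an equilibrium in the closed ball, hence
  \<open>a\<close>.\<close>

lemma stable_interior_basin: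
  assumes a: "a \<in> stable" shows "a \<in> interior (basin a)"
proof -
  obtain r where r: "0 < r" "\<And>x. x \<in> cball a r \<Longrightarrow> x \<noteq> a \<Longrightarrow> f a < f x \<and> G x \<noteq> 0"
    using stable_strict_min[OF a] by blast
  have "sphere a r \<noteq> {}" using r(1) by (simp add: sphere_eq_empty)
  then obtain s where s: "s \<in> sphere a r" "\<And>x. x \<in> sphere a r \<Longrightarrow> f s \<le> f x"
    using continuous_attains_inf[of "sphere a r" f] f_cont by auto
  have sa: "f a < f s" using r(1) r(2)[of s] s(1) by auto
  define V where "V = ball a r \<inter> {x. f x < f s}"
  have "open V" unfolding V_def
    by (intro open_Int open_ball open_Collect_less f_cont continuous_on_const)
  moreover have "a \<in> V" using sa r(1) by (simp add: V_def)
  moreover have "V \<subseteq> basin a"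
  proof
    fix z assume z: "z \<in> V"
    obtain x where x: "trajectory F x" "x 0 = z" by (rule trajectory_exists)
    have "dist (x t) a \<le> r" if t: "0 \<le> t" for t
    proof (rule ccontr)
      assume "\<not> dist (x t) a \<le> r"
      then have "\<exists>u. 0 \<le> u \<and> u \<le> t \<and> dist (x u) a = r"
        using z t x(2)
        by (intro IVT') (auto intro!: continuous_intros trajectory_cont[OF x(1)] simp: V_def dist_commute)
      then obtain u where u: "0 \<le> u" "dist (x u) a = r" by blast
      then have "f s \<le> f (x 0)"
        using s(2)[of "x u"] trajectory_f_decreasing[OF x(1) u(1)] by (simp add: dist_commute)
      then show False using z x(2) by (simp add: V_def)
    qed
    then have ev: "\<forall>\<^sub>F t in at_top. x t \<in> cball a r"
      by (intro eventually_mono[OF eventually_ge_at_top[of 0]]) (simp add: dist_commute)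
    obtain e where e: "G e = 0" "(x \<longlongrightarrow> e) at_top" using trajectory_converges[OF x(1)] by blast
    have "e \<in> cball a r" by (rule Lim_in_closed_set[OF closed_cball ev _ e(2)]) simp
    then have "e = a" using r(2) e(1) by blast
    then show "z \<in> basin a" using e(2) x basin_iff by blast
  qed
  ultimately show ?thesis by (auto simp: interior_def)
qed

text \<open>The trajectory enters the interior of the basin at a finite time \<open>T\<close>;
  continuity of the time-\<open>T\<close> flow carries a neighbourhood along.\<close>

lemma open_basin:
  assumes a: "a \<in> stable" shows "open (basin a)"
  unfolding open_contains_ball
proof
  fix z assume z: "z \<in> basin a"
  obtain x where x: "trajectory F x" "x 0 = z" by (rule trajectory_exists)
  have "(x \<longlongrightarrow> a) at_top" using z x basin_iff by blast
  then have "\<forall>\<^sub>F t in at_top. x t \<in> interior (basin a)"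
    by (rule topological_tendstoD) (use stable_interior_basin[OF a] in auto)
  then obtain T where T: "0 \<le> T" "x T \<in> interior (basin a)"
    unfolding eventually_at_top_linorder by (metis linear order_refl)
  then obtain e where e: "0 < e" "ball (x T) e \<subseteq> basin a" by (auto simp: mem_interior)
  obtain B where B: "0 < B" "\<And>x y. trajectory F x \<Longrightarrow> trajectory F y \<Longrightarrow> f (x 0) \<le> f z + 1 \<Longrightarrow>
      f (y 0) \<le> f z + 1 \<Longrightarrow> norm (x T - y T) \<le> B * norm (x 0 - y 0)"
    using flow_lipschitz[OF T(1), of "f z + 1"] by metis
  have "open {y. f y < f z + 1}" by (intro open_Collect_less f_cont continuous_on_const)
  then obtain d where d: "0 < d" "ball z d \<subseteq> {y. f y < f z + 1}"
    by (rule openE[of _ z]) auto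
  have "ball z (min d (e / B)) \<subseteq> basin a"
  proof
    fix w assume w: "w \<in> ball z (min d (e / B))"
    obtain y where y: "trajectory F y" "y 0 = w" by (rule trajectory_exists)
    have "f w < f z + 1" using w d(2) by auto
    then have "norm (x T - y T) \<le> B * norm (z - w)" using B(2)[OF x(1) y(1)] x(2) y(2) by simp
    also have "\<dots> < e" using w B(1) by (simp add: dist_norm field_simps)
    finally have "y T \<in> basin a" using e(2) by (auto simp: dist_norm)
    then show "w \<in> basin a" using basin_shift[OF y(1)] y(2) by blast
  qed
  then show "\<exists>k>0. ball z k \<subseteq> basin a" using d(1) e(1) B(1) by (intro exI[of _ "min d (e / B)"]) auto
qed

section \<open>Negligibility of unstable basins\<close>

text \<open>Near an equilibrium the form \<open>Q z = z \<bullet> H a z\<close> satisfies \<open>Q' \<le> c Q\<close> along differences of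
  trajectories. Hence \<open>Q\<close> cannot be negative on the difference of two trajectories that both
  remain near \<open>a\<close>. This replaces the stable manifold theorem.\<close>

lemma equilibrium_chords:
  assumes a: "G a = 0"
  obtains r where "0 < r"
    "\<And>x y. trajectory F x \<Longrightarrow> trajectory F y \<Longrightarrow> (\<And>t. 0 \<le> t \<Longrightarrow> x t \<in> ball a r \<and> y t \<in> ball a r) \<Longrightarrow>
      0 \<le> (y 0 - x 0) \<bullet> H a (y 0 - x 0)"
proof -
  have linH: "linear (H a)" and linN: "linear (N a)"
    by (simp_all add: blinfun.bounded_linear_right bounded_linear.linear)
  obtain n where n: "0 < n" "\<And>v. n * (norm v)\<^sup>2 \<le> v \<bullet> N a v"
    using pos_bounded_below[OF linN N_pos] by blast
  have "inj (blinfun_apply (H a))" using H_inj[OF a] by (simp add: linear_injective_0 linH)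
  then obtain m where m: "0 < m" "\<And>u. m * norm u \<le> norm (H a u)"
    using linear_inj_bounded_below_pos[OF linH] by blast
  define h where "h = norm (H a) + 1"
  define k where "k = n * m\<^sup>2"
  have h: "0 < h" by (simp add: h_def add_nonneg_pos)
  have k: "0 < k" using n m by (simp add: k_def)
  have Hz: "norm (H a z) \<le> h * norm z" for z
    using norm_blinfun[of "H a" z] mult_right_mono[of "norm (H a)" h "norm z"] by (simp add: h_def)
  have Q_bound: "\<bar>z \<bullet> H a z\<bar> \<le> h * (norm z)\<^sup>2" for z
    using Cauchy_Schwarz_ineq2[of z "H a z"] mult_left_mono[OF Hz[of z] norm_ge_zero[of z]]
    by (simp add: power2_eq_square algebra_simps)
  \<comment> \<open>With this tolerance the linearisation error adds at most
    \<open>k * (norm (z t))\<^sup>2\<close> to \<open>Q'\<close>, half of the dissipation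
    \<open>2 * (w \<bullet> N a w)\<close>.\<close>
  have "0 < k / (2 * h)" using k h by simp
  then obtain r where r: "0 < r" "\<And>x y. x \<in> ball a r \<Longrightarrow> y \<in> ball a r \<Longrightarrow>
      norm (F y - F x + N a (H a (y - x))) \<le> k / (2 * h) * norm (y - x)"
    using F_strict[OF a] by blast
  show thesis
  proof (rule that[OF r(1)])
    fix x y assume x: "trajectory F x" and y: "trajectory F y"
      and ball: "\<And>t. 0 \<le> t \<Longrightarrow> x t \<in> ball a r \<and> y t \<in> ball a r"
    define z where "z t = y t - x t" for t
    define Q where "Q t = z t \<bullet> H a (z t)" for t
    define Q' where "Q' t = 2 * (H a (z t) \<bullet> (F (y t) - F (x t)))" for t
    have der: "(Q has_real_derivative Q' t) (at t)" for t
    proof -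
      have z: "(z has_derivative (\<lambda>h. h *\<^sub>R (F (y t) - F (x t)))) (at t)"
        using has_vector_derivative_diff x y
        unfolding trajectory_def has_vector_derivative_def z_def[abs_def] by blast
      have "((\<lambda>t. H a (z t)) has_derivative (\<lambda>h. H a (h *\<^sub>R (F (y t) - F (x t))))) (at t)"
        by (rule bounded_linear.has_derivative[OF blinfun.bounded_linear_right z])
      from has_derivative_inner[OF z this] show ?thesis
        unfolding has_field_derivative_def Q_def[abs_def] Q'_def
        by (rule has_derivative_eq_rhs) (simp add: fun_eq_iff blinfun.scaleR_right H_sym inner_commute)
    qed
    have Q': "Q' t \<le> k / h * Q t" if t: "0 \<le> t" for t
    proof -
      define w where "w = H a (z t)"
      define d where "d = F (y t) - F (x t) + N a w"
      have "norm w * norm d \<le> (h * norm (z t)) * (k / (2 * h) * norm (z t))"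
        using r(2) ball[OF t] Hz[of "z t"] h unfolding d_def w_def z_def by (intro mult_mono) auto
      then have "\<bar>w \<bullet> d\<bar> \<le> k / 2 * (norm (z t))\<^sup>2"
        using Cauchy_Schwarz_ineq2[of w d] h by (simp add: power2_eq_square field_simps)
      moreover have "k * (norm (z t))\<^sup>2 \<le> w \<bullet> N a w"
      proof -
        have "k * (norm (z t))\<^sup>2 = n * (m * norm (z t))\<^sup>2" by (simp add: k_def power_mult_distrib)
        also have "\<dots> \<le> n * (norm w)\<^sup>2"
          using m n unfolding w_def by (intro mult_left_mono power_mono) auto
        finally show ?thesis using n(2)[of w] by linarith
      qed
      moreover have "Q' t = 2 * (w \<bullet> d) - 2 * (w \<bullet> N a w)"
        by (simp add: Q'_def d_def w_def[symmetric] inner_add_right)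
      ultimately have "Q' t \<le> - (k * (norm (z t))\<^sup>2)" by linarith
      moreover have "- (k * (norm (z t))\<^sup>2) \<le> k / h * Q t"
      proof -
        have "k / h * (- (h * (norm (z t))\<^sup>2)) \<le> k / h * Q t"
          using Q_bound[of "z t"] k h unfolding Q_def by (intro mult_left_mono) auto
        then show ?thesis using h by simp
      qed
      ultimately show ?thesis by linarith
    qed
    define c where "c = k / h"
    have c: "0 < c" using k h by (simp add: c_def)
    have grow: "Q T \<le> Q 0 * exp (c * T)" if T: "0 \<le> T" for T
    proof -
      have "Q T * exp (- c * T) \<le> Q 0 * exp (- c * 0)"
      proof (rule DERIV_nonpos_imp_nonincreasing[OF T])
        fix t :: real assume "0 \<le> t"
        then have "(Q' t - c * Q t) * exp (- c * t) \<le> 0"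
          using Q'[of t] by (intro mult_nonpos_nonneg) (auto simp: c_def)
        moreover have "((\<lambda>t. Q t * exp (- c * t)) has_real_derivative (Q' t - c * Q t) * exp (- c * t)) (at t)"
          by (auto intro!: derivative_eq_intros der simp: algebra_simps)
        ultimately show "\<exists>z. ((\<lambda>t. Q t * exp (- c * t)) has_real_derivative z) (at t) \<and> z \<le> 0" by blast
      qed
      then show ?thesis by (simp add: exp_minus field_simps)
    qed
    show "0 \<le> (y 0 - x 0) \<bullet> H a (y 0 - x 0)"
    proof (rule ccontr)
      assume "\<not> 0 \<le> (y 0 - x 0) \<bullet> H a (y 0 - x 0)"
      then have Q0: "Q 0 < 0" by (simp add: Q_def z_def)
      \<comment> \<open>By this time even the linear bound \<open>1 + c * T\<close> for the
        exponential forces \<open>- Q T\<close> above \<open>h * (2 * r)\<^sup>2\<close>, which no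
        two points of the ball allow.\<close>
      define T where "T = h * (2 * r)\<^sup>2 / (c * - Q 0)"
      have T: "0 \<le> T" using h c Q0 by (simp add: T_def divide_nonneg_neg mult_pos_neg)
      have "Q T \<le> Q 0 * exp (c * T)" by (rule grow[OF T])
      also have "\<dots> \<le> Q 0 * (1 + c * T)"
        using Q0 exp_ge_add_one_self[of "c * T"] by (intro mult_left_mono_neg) auto
      also have "\<dots> = Q 0 - h * (2 * r)\<^sup>2" using c Q0 by (simp add: T_def field_simps)
      finally have "h * (2 * r)\<^sup>2 < - Q T" using Q0 by linarith
      also have "\<dots> \<le> h * (norm (z T))\<^sup>2" using Q_bound[of "z T"] by (simp add: Q_def)
      also have "\<dots> \<le> h * (2 * r)\<^sup>2"
      proof -
        have "norm (z T) \<le> 2 * r"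
          using ball[OF T] dist_triangle3[of "y T" "x T" a] by (simp add: z_def dist_norm[symmetric])
        then show ?thesis using h by (intro mult_left_mono power_mono) auto
      qed
      finally show False by simp
    qed
  qed
qed

text \<open>Every basin trajectory finally stays in a small ball, so from some integer time on it
  runs in the negligible set \<open>W\<close>. The flow up to that time does not contract sublevel
  sets too much, so its preimage of \<open>W\<close> within each is negligible, and countably many
  such sets cover the basin.\<close>

lemma unstable_basin_negligible:
  assumes a: "G a = 0" "a \<notin> stable"
  shows "negligible (basin a)"
proof -
  have lin: "linear (H a)" by (simp add: blinfun.bounded_linear_right bounded_linear.linear)
  obtain v where v: "v \<bullet> H a v < 0"
    using symmetric_negative_direction[OF lin H_sym H_inj[OF a(1)]] a by (auto simp: stable_def)
  obtain r where r: "0 < r"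
    "\<And>x y. trajectory F x \<Longrightarrow> trajectory F y \<Longrightarrow> (\<And>t. 0 \<le> t \<Longrightarrow> x t \<in> ball a r \<and> y t \<in> ball a r) \<Longrightarrow>
      0 \<le> (y 0 - x 0) \<bullet> H a (y 0 - x 0)"
    using equilibrium_chords[OF a(1)] by blast
  define W where "W = {x 0 |x. trajectory F x \<and> (\<forall>t\<ge>0. x t \<in> ball a r)}"
  have W: "negligible W"
    by (rule negligible_cone_condition[OF blinfun.bounded_linear_right v]) (use r(2) in \<open>auto simp: W_def\<close>)
  obtain flow where flow: "\<And>z. trajectory F (flow z)" "\<And>z. flow z 0 = z"
    using complete unfolding complete_field_def by metis
  \<comment> \<open>One index bounds both the energy, for a uniform flow constant, and the entry
    time, for a countable union.\<close>
  define E where "E n = {z. f z \<le> real n \<and> (\<forall>t\<ge>real n. flow z t \<in> ball a r)}" for n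
  have "negligible (E n)" for n
  proof -
    obtain B where B: "\<And>x y. trajectory F x \<Longrightarrow> trajectory F y \<Longrightarrow> f (x 0) \<le> real n \<Longrightarrow>
        f (y 0) \<le> real n \<Longrightarrow> norm (x 0 - y 0) \<le> B * norm (x (real n) - y (real n))"
      using flow_lipschitz[of "real n" "real n"] by (metis of_nat_0_le_iff)
    have "flow z n \<in> W" if "z \<in> E n" for z
      unfolding W_def using that trajectory_shift[OF flow(1)[of z], of n]
      by (intro CollectI exI[of _ "\<lambda>t. flow z (t + real n)"]) (auto simp: E_def)
    then have "negligible ((\<lambda>z. flow z n) ` E n)" by (intro negligible_subset[OF W]) auto
    then show ?thesis
    proof (rule negligible_expanding)
      fix x y assume "x \<in> E n" "y \<in> E n"
      then show "norm (y - x) \<le> B * norm (flow y n - flow x n)"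
        using B[OF flow(1) flow(1), of y x] by (simp add: flow(2) E_def)
    qed
  qed
  then have "negligible (\<Union>n. E n)" by (rule negligible_Union_nat)
  moreover have "basin a \<subseteq> (\<Union>n. E n)"
  proof
    fix z assume "z \<in> basin a"
    then have "(flow z \<longlongrightarrow> a) at_top" using basin_iff[OF flow(1)] flow(2) by metis
    then have "\<forall>\<^sub>F t in at_top. flow z t \<in> ball a r"
      by (rule topological_tendstoD) (use r(1) in auto)
    then obtain T where T: "\<And>t. T \<le> t \<Longrightarrow> flow z t \<in> ball a r" by (auto simp: eventually_at_top_linorder)
    obtain n :: nat where "max T (f z) \<le> real n" using real_arch_simple by blast
    then have "z \<in> E n" using T by (auto simp: E_def)
    then show "z \<in> (\<Union>n. E n)" by blast
  qed
  ultimately show ?thesis by (rule negligible_subset)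
qed

section \<open>Covering by the stable cells and their overlaps\<close>

lemma finite_stable: "finite stable"
  by (rule finite_subset[OF _ finite_equilibria]) (auto simp: stable_def)

lemma negligible_outside_stable_basins: "negligible (- (\<Union>a\<in>stable. basin a))"
proof (rule negligible_subset)
  show "negligible (\<Union>a\<in>{a. G a = 0} - stable. basin a)"
    using finite_equilibria unstable_basin_negligible by (intro negligible_Union) auto
  show "- (\<Union>a\<in>stable. basin a) \<subseteq> (\<Union>a\<in>{a. G a = 0} - stable. basin a)"
    using basins_cover by blast
qed

text \<open>Finitely many closed cells leave an open complement; being negligible, it is
  empty.\<close>

lemma stable_cells_cover: "(\<Union>a\<in>stable. closure (basin a)) = UNIV"
proof -
  have "- (\<Union>a\<in>stable. closure (basin a)) \<subseteq> - (\<Union>a\<in>stable. basin a)"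
    using closure_subset by fastforce
  then have "negligible (- (\<Union>a\<in>stable. closure (basin a)))"
    using negligible_outside_stable_basins negligible_subset by blast
  moreover have "open (- (\<Union>a\<in>stable. closure (basin a)))"
    using finite_stable by (intro open_Compl closed_UN) auto
  ultimately show ?thesis using open_not_negligible by blast
qed

text \<open>An open basin disjoint from another also misses its closure, so the overlap of two cells
  avoids every stable basin.\<close>

lemma stable_cells_overlap:
  assumes a: "a \<in> stable" and b: "b \<in> stable" and ab: "a \<noteq> b"
  shows "negligible (closure (basin a) \<inter> closure (basin b))"
proof (rule negligible_subset[OF negligible_outside_stable_basins])
  have disj: "closure (basin d) \<inter> basin c = {}" if "c \<in> stable" "c \<noteq> d" for c d
    using basin_disjoint[OF that(2)] open_Int_closure_eq_empty[OF open_basin[OF that(1)]] by blast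
  have "closure (basin a) \<inter> closure (basin b) \<inter> basin c = {}" if "c \<in> stable" for c
    using disj[OF that, of a] disj[OF that, of b] ab by (cases "c = a") auto
  then show "closure (basin a) \<inter> closure (basin b) \<subseteq> - (\<Union>c\<in>stable. basin c)" by blast
qed

end

section \<open>Matrices as bounded linear maps and the inverse metric\<close>

lemma bounded_linear_Blinfun_matrix: "bounded_linear (\<lambda>A::real^'n^'n. Blinfun ((*v) A))"
proof -
  have app: "blinfun_apply (Blinfun ((*v) A)) = (*v) A" for A :: "real^'n^'n"
    by (rule bounded_linear_Blinfun_apply) (rule matrix_vector_mul_bounded_linear)
  show ?thesis
    unfolding linear_conv_bounded_linear[symmetric]
    by (intro linearI blinfun_eqI)
      (simp_all add: app plus_blinfun.rep_eq scaleR_blinfun.rep_eq matrix_vector_mult_add_rdistrib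
        scaleR_matrix_vector_assoc)
qed

lemma Blinfun_matrix_apply [simp]: "Blinfun ((*v) A) v = A *v v" for A :: "real^'n^'n"
  by (simp add: bounded_linear_Blinfun_apply matrix_vector_mul_bounded_linear)

lemma matrix_inv_vector:
  fixes A :: "real^'n^'n" assumes "invertible A"
  shows "A *v (matrix_inv A *v v) = v" "matrix_inv A *v (A *v v) = v"
proof -
  have "A ** matrix_inv A = mat 1" "matrix_inv A ** A = mat 1"
    using assms unfolding invertible_def matrix_inv_def by (metis (mono_tags, lifting) someI_ex)+
  then show "A *v (matrix_inv A *v v) = v" "matrix_inv A *v (A *v v) = v"
    by (simp_all add: matrix_vector_mul_assoc)
qed

lemma sym_pos_def_matrix_inv:
  fixes A :: "real^'n^'n" assumes A: "sym_pos_def A"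
  shows "sym_pos_def (matrix_inv A)"
proof -
  have inv: "invertible A" using A by (simp add: sym_pos_def_def pos_def_invertible)
  have "0 < v \<bullet> (matrix_inv A *v v)" if v: "v \<noteq> 0" for v
  proof -
    have "matrix_inv A *v v \<noteq> 0" using matrix_inv_vector(1)[OF inv, of v] v by auto
    then have "0 < (matrix_inv A *v v) \<bullet> (A *v (matrix_inv A *v v))"
      using A by (simp add: sym_pos_def_def pos_def_def)
    then show ?thesis by (simp add: matrix_inv_vector(1)[OF inv] inner_commute)
  qed
  then show ?thesis
    using A transpose_matrix_inv_sym[OF inv] by (simp add: sym_pos_def_def pos_def_def)
qed

lemma sym_pos_def_inner: "sym_pos_def A \<Longrightarrow> (A *v u) \<bullet> v = u \<bullet> (A *v v)"
  unfolding sym_pos_def_def by (metis dot_lmul_matrix vector_transpose_matrix)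

lemma sym_pos_def_bounded_below:
  assumes "sym_pos_def A"
  obtains c where "0 < c" "\<And>v. c * (norm v)\<^sup>2 \<le> v \<bullet> (A *v v)"
  using pos_bounded_below[of "(*v) A"] assms
  by (auto simp: sym_pos_def_def pos_def_def matrix_vector_mul_linear)

text \<open>Continuous partial derivatives along the basis vectors make the derivative continuous in
  operator norm, so the C1 estimate applies.\<close>

lemma smooth_lipschitz_on_cball:
  fixes g :: "real^'n \<Rightarrow> 'b::real_normed_vector"
  assumes "smooth g"
  shows "\<exists>L. L-lipschitz_on (cball a r) g"
proof -
  have "C_upto 1 g" using assms by (simp add: smooth_def)
  then have diff: "\<And>x. g differentiable (at x)"
    and part: "\<And>i. continuous_on UNIV (\<lambda>x. frechet_derivative g (at x) (axis i 1))"
    by auto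
  have der: "(g has_derivative blinfun_apply (Blinfun (frechet_derivative g (at x)))) (at x)" for x
    using diff[of x]
    by (metis bounded_linear_Blinfun_apply frechet_derivative_works has_derivative_bounded_linear)
  have app: "blinfun_apply (Blinfun (frechet_derivative g (at x))) = frechet_derivative g (at x)" for x
    using der frechet_derivative_at by blast
  show ?thesis
  proof (rule C1_lipschitz_on_cball[OF der])
    show "continuous_on UNIV (\<lambda>x. Blinfun (frechet_derivative g (at x)))"
      by (rule continuous_on_blinfun_componentwise) (use part in \<open>auto simp: app Basis_vec_def\<close>)
  qed
qed

text \<open>Inversion is Lipschitz where the inverses are uniformly bounded, by the identity for a
  difference of inverses. For negative \<open>r\<close> the ball is empty.\<close>

lemma metric_inverse_lipschitz:
  fixes R :: "real^'n \<Rightarrow> real^'n^'n"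
  assumes R: "riemannian_metric R"
  shows "\<exists>L. L-lipschitz_on (cball 0 r) (\<lambda>x. Blinfun ((*v) (matrix_inv (R x))))"
proof (cases "0 \<le> r")
  case True
  define T where "T x = Blinfun ((*v) (R x))" for x
  define N where "N x = Blinfun ((*v) (matrix_inv (R x)))" for x
  have inv: "invertible (R x)" for x
    using R by (simp add: riemannian_metric_def sym_pos_def_def pos_def_invertible)
  have TN: "T x (N x v) = v" "N x (T x v) = v" for x v
    by (simp_all add: T_def N_def matrix_inv_vector[OF inv])
  obtain L where L: "L-lipschitz_on (cball 0 r) R"
    using R smooth_lipschitz_on_cball[of R 0 r] by (auto simp: riemannian_metric_def)
  obtain K where K: "0 < K" "\<And>A::real^'n^'n. norm (Blinfun ((*v) A)) \<le> norm A * K"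
    using bounded_linear.pos_bounded[OF bounded_linear_Blinfun_matrix] by blast
  have T_lip: "norm (T x - T y) \<le> L * K * norm (x - y)" if "x \<in> cball 0 r" "y \<in> cball 0 r" for x y
  proof -
    have "norm (T x - T y) = norm (Blinfun ((*v) (R x - R y)))"
      unfolding T_def
      by (subst linear_diff[OF bounded_linear.linear[OF bounded_linear_Blinfun_matrix]]) (rule refl)
    also have "\<dots> \<le> norm (R x - R y) * K" by (rule K(2))
    also have "\<dots> \<le> L * norm (x - y) * K"
      using lipschitz_onD[OF L that] K(1) by (intro mult_right_mono) (auto simp: dist_norm)
    finally show ?thesis by (simp add: mult_ac)
  qed
  have T_cont: "continuous_on (cball 0 r) T"
  proof -
    have "continuous_on (cball 0 r) (\<lambda>x. Blinfun ((*v) (R x)))"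
      by (rule bounded_linear.continuous_on[OF bounded_linear_Blinfun_matrix])
        (rule lipschitz_on_continuous_on[OF L])
    then show ?thesis by (simp add: T_def[abs_def])
  qed
  \<comment> \<open>Minimising the form jointly over points and unit vectors gives a single lower
    bound \<open>m\<close> on the ball, hence the bound \<open>inverse m\<close> for all
    \<open>N x\<close>.\<close>
  define C where "C = cball (0::real^'n) r \<times> sphere (0::real^'n) 1"
  have "continuous_on C (\<lambda>z. T (fst z))"
    by (rule continuous_on_compose2[OF T_cont continuous_on_fst[OF continuous_on_id]]) (auto simp: C_def)
  then have "continuous_on C (\<lambda>z. snd z \<bullet> T (fst z) (snd z))"
    by (intro continuous_intros)
  moreover have "compact C" "C \<noteq> {}" using True by (auto simp: C_def compact_Times sphere_eq_empty)
  ultimately obtain z where z: "z \<in> C" "\<And>y. y \<in> C \<Longrightarrow> snd z \<bullet> T (fst z) (snd z) \<le> snd y \<bullet> T (fst y) (snd y)"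
    using continuous_attains_inf[of C "\<lambda>z. snd z \<bullet> T (fst z) (snd z)"] by blast
  define m where "m = snd z \<bullet> T (fst z) (snd z)"
  have "snd z \<noteq> 0" using z(1) by (auto simp: C_def)
  then have m: "0 < m"
    using R by (simp add: m_def T_def riemannian_metric_def sym_pos_def_def pos_def_def)
  have N_bound: "norm (N x) \<le> inverse m" if x: "x \<in> cball 0 r" for x
  proof (rule norm_blinfun_bound)
    fix u :: "real^'n"
    define v where "v = N x u"
    have u: "u = T x v" by (simp add: v_def TN)
    have "m * norm v \<le> norm u"
    proof (cases "v = 0")
      case False
      then have "m \<le> (v /\<^sub>R norm v) \<bullet> T x (v /\<^sub>R norm v)"
        using z(2)[of "(x, v /\<^sub>R norm v)"] x by (simp add: m_def C_def)
      also have "\<dots> = (v \<bullet> u) / (norm v)\<^sup>2"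
        using False by (simp add: u blinfun.scaleR_right power2_eq_square field_simps)
      finally have "m * (norm v)\<^sup>2 \<le> v \<bullet> u" using False by (simp add: field_simps)
      also have "\<dots> \<le> norm v * norm u" by (rule norm_cauchy_schwarz)
      finally show ?thesis using False by (simp add: power2_eq_square)
    qed simp
    then show "norm (N x u) \<le> inverse m * norm u" using m by (simp add: v_def field_simps)
  qed (use m in simp)
  have "(inverse m * (L * K) * inverse m)-lipschitz_on (cball 0 r) N"
  proof (rule lipschitz_onI)
    show "0 \<le> inverse m * (L * K) * inverse m" using m K(1) lipschitz_on_nonneg[OF L] by simp
    fix x y :: "real^'n" assume xy: "x \<in> cball 0 r" "y \<in> cball 0 r"
    have "N x - N y = N x o\<^sub>L ((T y - T x) o\<^sub>L N y)"
      by (rule blinfun_eqI) (simp add: blinfun.diff_left blinfun.diff_right TN)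
    then have "norm (N x - N y) \<le> norm (N x) * (norm (T y - T x) * norm (N y))"
      by (auto intro!: order_trans[OF norm_blinfun_compose] mult_left_mono norm_blinfun_compose)
    also have "\<dots> \<le> inverse m * (L * K * norm (y - x) * inverse m)"
      using N_bound[OF xy(1)] N_bound[OF xy(2)] T_lip[OF xy(2,1)] m K(1) lipschitz_on_nonneg[OF L]
      by (intro mult_mono) auto
    finally show "dist (N x) (N y) \<le> inverse m * (L * K) * inverse m * dist x y"
      by (simp add: dist_norm norm_minus_commute mult_ac)
  qed
  then show ?thesis unfolding N_def by blast
qed (auto simp: lipschitz_on_def)

section \<open>Gradient, Hessian and growth of the negative log density\<close>

context
  fixes K :: nat and w :: "nat \<Rightarrow> real" and \<mu> :: "nat \<Rightarrow> real^'n" and S :: "nat \<Rightarrow> real^'n^'n"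
  assumes params: "mog_params K w \<mu> S"
begin

lemma K_pos: "0 < K"
  using params by (auto simp: mog_params_def intro: ccontr)

lemma weight_pos: "k \<in> {1..K} \<Longrightarrow> 0 < w k"
  and S_pos: "k \<in> {1..K} \<Longrightarrow> sym_pos_def (S k)"
  and S_inv_pos: "k \<in> {1..K} \<Longrightarrow> sym_pos_def (matrix_inv (S k))"
  using params by (auto simp: mog_params_def sym_pos_def_matrix_inv)

lemma mog_pos: "0 < mog K w \<mu> S x"
  unfolding mog_def using K_pos by (intro sum_pos mult_pos_pos weight_pos gauss_pos S_pos) auto

lemma mog_weight_pos: "k \<in> {1..K} \<Longrightarrow> 0 < mog_weight K w \<mu> S k x"
  using mog_pos[of x] unfolding mog_weight_def mog_def
  by (intro divide_pos_pos mult_pos_pos weight_pos gauss_pos S_pos)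

text \<open>The gradient of minus the logarithm of the \<open>k\<close>-th Gaussian.\<close>

definition score :: "nat \<Rightarrow> real^'n \<Rightarrow> real^'n" where
  "score k x = matrix_inv (S k) *v (x - \<mu> k)"

definition mog_grad :: "real^'n \<Rightarrow> real^'n" where
  "mog_grad x = (\<Sum>k=1..K. mog_weight K w \<mu> S k x *\<^sub>R score k x)"

text \<open>The product rule for \<open>mog_grad\<close>. As a form it is the weighted mean of the
  inverse covariances minus the weighted covariance of the scores.\<close>

definition mog_hess :: "real^'n \<Rightarrow> real^'n \<Rightarrow> real^'n" where
  "mog_hess x h = (\<Sum>k=1..K. mog_weight K w \<mu> S k x *\<^sub>R
      ((h \<bullet> mog_grad x - h \<bullet> score k x) *\<^sub>R score k x + matrix_inv (S k) *v h))"

lemma gderiv_neg_ln_mog: "GDERIV (\<lambda>x. - ln (mog K w \<mu> S x)) x :> mog_grad x"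
  using GDERIV_minus[OF gderiv_ln_mog[OF params]] by (simp add: mog_grad_def score_def)

lemma component_deriv:
  assumes k: "k \<in> {1..K}"
  shows "((\<lambda>x. w k * gauss (\<mu> k) (S k) x) has_derivative
    (\<lambda>h. - (w k * gauss (\<mu> k) (S k) x * (h \<bullet> score k x)))) (at x)"
proof -
  have "(gauss (\<mu> k) (S k) has_derivative
      (\<lambda>h. gauss (\<mu> k) (S k) x * - (h \<bullet> (matrix_inv (S k) *v (x - \<mu> k))))) (at x)"
    using S_inv_pos[OF k] unfolding gauss_def[abs_def] by (intro gauss_has_derivative) (simp add: sym_pos_def_def)
  from has_derivative_mult_right[OF this, of "w k"] show ?thesis
    by (rule has_derivative_eq_rhs) (simp add: score_def fun_eq_iff)
qed

lemma mog_deriv: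
  "(mog K w \<mu> S has_derivative (\<lambda>h. - (mog K w \<mu> S x * (h \<bullet> mog_grad x)))) (at x)"
proof -
  have "(mog K w \<mu> S has_derivative
      (\<lambda>h. \<Sum>k=1..K. - (w k * gauss (\<mu> k) (S k) x * (h \<bullet> score k x)))) (at x)"
    unfolding mog_def[abs_def] by (intro has_derivative_sum component_deriv)
  moreover have "mog K w \<mu> S x * (h \<bullet> mog_grad x) = (\<Sum>k=1..K. w k * gauss (\<mu> k) (S k) x * (h \<bullet> score k x))" for h
    using mog_pos[of x] unfolding mog_grad_def mog_weight_def mog_def[symmetric]
    by (simp add: inner_sum_right sum_distrib_left)
  ultimately show ?thesis by (simp add: sum_negf)
qed

lemma mog_weight_deriv:
  assumes k: "k \<in> {1..K}"
  shows "(mog_weight K w \<mu> S k has_derivative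
    (\<lambda>h. mog_weight K w \<mu> S k x * (h \<bullet> mog_grad x - h \<bullet> score k x))) (at x)"
proof -
  have eq: "mog_weight K w \<mu> S k = (\<lambda>x. (w k * gauss (\<mu> k) (S k) x) / mog K w \<mu> S x)"
    by (simp add: mog_weight_def mog_def fun_eq_iff)
  show ?thesis
    unfolding eq
    by (rule has_derivative_eq_rhs[OF has_derivative_divide'[OF component_deriv[OF k] mog_deriv]])
      (use mog_pos[of x] in \<open>auto simp: fun_eq_iff field_simps\<close>)
qed

lemma score_deriv: "(score k has_derivative (\<lambda>h. matrix_inv (S k) *v h)) (at x)"
  unfolding score_def[abs_def]
  by (rule bounded_linear.has_derivative[OF matrix_vector_mul_bounded_linear])
    (auto intro!: derivative_eq_intros)

lemma mog_grad_deriv: "(mog_grad has_derivative mog_hess x) (at x)"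
proof -
  have "(mog_grad has_derivative (\<lambda>h. \<Sum>k=1..K.
      mog_weight K w \<mu> S k x *\<^sub>R (matrix_inv (S k) *v h)
      + (mog_weight K w \<mu> S k x * (h \<bullet> mog_grad x - h \<bullet> score k x)) *\<^sub>R score k x)) (at x)"
    unfolding mog_grad_def[abs_def]
    by (intro has_derivative_sum has_derivative_scaleR[OF mog_weight_deriv[unfolded mog_grad_def] score_deriv])
  then show ?thesis
    by (rule has_derivative_eq_rhs) (simp add: mog_hess_def fun_eq_iff scaleR_right_distrib add.commute)
qed

lemma mog_hess_apply: "blinfun_apply (Blinfun (mog_hess x)) = mog_hess x"
  using mog_grad_deriv by (intro bounded_linear_Blinfun_apply has_derivative_bounded_linear)

lemma mog_hess_cont: "continuous_on UNIV (\<lambda>x. Blinfun (mog_hess x))"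
proof (rule continuous_on_blinfun_componentwise)
  fix h :: "real^'n"
  have "continuous_on UNIV (score k)" for k
    using score_deriv by (blast intro: continuous_at_imp_continuous_on has_derivative_continuous)
  moreover have "continuous_on UNIV mog_grad"
    using mog_grad_deriv by (blast intro: continuous_at_imp_continuous_on has_derivative_continuous)
  moreover have "continuous_on UNIV (mog_weight K w \<mu> S k)" if "k \<in> {1..K}" for k
    using mog_weight_deriv[OF that] by (blast intro: continuous_at_imp_continuous_on has_derivative_continuous)
  ultimately show "continuous_on UNIV (\<lambda>x. Blinfun (mog_hess x) h)"
    unfolding mog_hess_apply mog_hess_def by (intro continuous_intros) auto
qed

lemma mog_hess_sym: "mog_hess x u \<bullet> v = u \<bullet> mog_hess x v"
proof -
  have expand: "mog_hess x u \<bullet> v = (u \<bullet> mog_grad x) * (mog_grad x \<bullet> v)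
      - (\<Sum>k=1..K. mog_weight K w \<mu> S k x * ((u \<bullet> score k x) * (score k x \<bullet> v)))
      + (\<Sum>k=1..K. mog_weight K w \<mu> S k x * ((matrix_inv (S k) *v u) \<bullet> v))" for u v
    \<comment> \<open>Only the factor \<open>mog_grad x \<bullet> v\<close> is expanded into scores;
      the other already occurs in \<open>mog_hess\<close>.\<close>
    by (subst (2) mog_grad_def)
      (simp add: mog_hess_def inner_sum_left inner_add_left sum_distrib_left sum.distrib[symmetric]
        sum_subtractf[symmetric] algebra_simps)
  have "u \<bullet> mog_hess x v = mog_hess x v \<bullet> u" by (rule inner_commute)
  also have "\<dots> = mog_hess x u \<bullet> v"
    unfolding expand using sym_pos_def_inner[OF S_inv_pos]
    by (auto simp: inner_commute mult_ac intro!: sum.cong)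
  finally show ?thesis by simp
qed

lemma grad_neg_ln_mog: "grad (\<lambda>x. - ln (mog K w \<mu> S x)) = mog_grad"
  using gderiv_neg_ln_mog by (auto intro: grad_eqI)

lemma hessian_neg_ln_mog: "hessian (\<lambda>x. - ln (mog K w \<mu> S x)) x *v h = mog_hess x h"
proof -
  have "frechet_derivative mog_grad (at x) = mog_hess x"
    using frechet_derivative_at[OF mog_grad_deriv] by simp
  moreover have "linear (mog_hess x)" using mog_grad_deriv has_derivative_linear by blast
  ultimately show ?thesis
    unfolding hessian_def grad_neg_ln_mog jacobian_def by (simp add: matrix_works)
qed

text \<open>Each exponent is bounded by a negative multiple of the squared distance to the
  mean.\<close>

lemma mog_tendsto_0: "(mog K w \<mu> S \<longlongrightarrow> 0) at_infinity"
proof -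
  have "(gauss (\<mu> k) (S k) \<longlongrightarrow> 0) at_infinity" if k: "k \<in> {1..K}" for k
  proof -
    obtain c where c: "0 < c" "\<And>v. c * (norm v)\<^sup>2 \<le> v \<bullet> (matrix_inv (S k) *v v)"
      using sym_pos_def_bounded_below[OF S_inv_pos[OF k]] by blast
    have lim: "filterlim (\<lambda>x. norm (x - \<mu> k)) at_top at_infinity"
    proof (rule filterlim_at_top_mono)
      show "filterlim (\<lambda>x. - norm (\<mu> k) + norm x) at_top at_infinity"
        by (intro filterlim_tendsto_add_at_top[OF tendsto_const filterlim_norm_at_top])
      show "\<forall>\<^sub>F x in at_infinity. - norm (\<mu> k) + norm x \<le> norm (x - \<mu> k)"
        using norm_triangle_ineq2[of _ "\<mu> k"] by (auto simp: algebra_simps)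
    qed
    have "filterlim (\<lambda>x. c / 2 * (norm (x - \<mu> k))\<^sup>2) at_top at_infinity"
      using c(1) by (intro filterlim_tendsto_pos_mult_at_top[OF tendsto_const]
          filterlim_pow_at_top lim) auto
    then have "filterlim (\<lambda>x. 1 / 2 * ((x - \<mu> k) \<bullet> (matrix_inv (S k) *v (x - \<mu> k)))) at_top at_infinity"
      by (rule filterlim_at_top_mono) (use c(2) in auto)
    then have "filterlim (\<lambda>x. - (1 / 2 * ((x - \<mu> k) \<bullet> (matrix_inv (S k) *v (x - \<mu> k))))) at_bot at_infinity"
      by (rule filterlim_compose[OF filterlim_uminus_at_bot_at_top])
    then have "((\<lambda>x. exp (- 1 / 2 * ((x - \<mu> k) \<bullet> (matrix_inv (S k) *v (x - \<mu> k))))) \<longlongrightarrow> 0) at_infinity"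
      using filterlim_compose[OF exp_at_bot] by simp
    then show ?thesis unfolding gauss_def[abs_def] by (rule tendsto_mult_right_zero)
  qed
  then show ?thesis unfolding mog_def[abs_def]
    by (intro tendsto_null_sum tendsto_mult_right_zero)
qed

lemma neg_ln_mog_sublevel_bounded: "bounded {x. - ln (mog K w \<mu> S x) \<le> c}"
proof -
  have "\<forall>\<^sub>F x in at_infinity. mog K w \<mu> S x < exp (- c)"
    by (rule order_tendstoD[OF mog_tendsto_0]) simp
  then obtain b where b: "\<And>x. b \<le> norm x \<Longrightarrow> mog K w \<mu> S x < exp (- c)"
    by (auto simp: eventually_at_infinity)
  have "norm x \<le> b" if "- ln (mog K w \<mu> S x) \<le> c" for x
  proof (rule ccontr)
    assume "\<not> norm x \<le> b"
    then have "ln (mog K w \<mu> S x) < - c" using b[of x] mog_pos[of x] by (metis ln_exp ln_less_cancel_iff exp_gt_zero linear)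
    then show False using that by simp
  qed
  then show ?thesis by (auto simp: bounded_iff)
qed

text \<open>Far out, all scores have positive inner product with \<open>x\<close>, since the
  quadratic term beats the linear one; so their positively weighted sum cannot vanish.\<close>

lemma mog_grad_zeros_bounded: "bounded {x. mog_grad x = 0}"
proof -
  have "\<forall>\<^sub>F x in at_infinity. 0 < x \<bullet> score k x" if k: "k \<in> {1..K}" for k
  proof -
    obtain c where c: "0 < c" "\<And>v. c * (norm v)\<^sup>2 \<le> v \<bullet> (matrix_inv (S k) *v v)"
      using sym_pos_def_bounded_below[OF S_inv_pos[OF k]] by blast
    define b where "b = norm (matrix_inv (S k) *v \<mu> k)"
    \<comment> \<open>Beyond radius \<open>b / c\<close> the quadratic term dominates; the extra 1
      makes this strict and \<open>x\<close> nonzero.\<close>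
    have "0 < x \<bullet> score k x" if x: "b / c + 1 \<le> norm x" for x
    proof -
      have "0 \<le> b / c" using c(1) by (simp add: b_def)
      then have x0: "0 < norm x" using x by linarith
      have "b < c * norm x" using x c(1) by (simp add: field_simps)
      then have "norm x * b < c * (norm x)\<^sup>2" using x0 by (simp add: power2_eq_square)
      moreover have "x \<bullet> (matrix_inv (S k) *v \<mu> k) \<le> norm x * b" unfolding b_def by (rule norm_cauchy_schwarz)
      ultimately show ?thesis
        using c(2)[of x] by (simp add: score_def matrix_vector_mult_diff_distrib inner_diff_right)
    qed
    then show ?thesis unfolding eventually_at_infinity by blast
  qed
  then have "\<forall>\<^sub>F x in at_infinity. \<forall>k\<in>{1..K}. 0 < x \<bullet> score k x"
    by (simp add: eventually_ball_finite)
  then obtain b where b: "\<And>x k. b \<le> norm x \<Longrightarrow> k \<in> {1..K} \<Longrightarrow> 0 < x \<bullet> score k x"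
    unfolding eventually_at_infinity by blast
  have "norm x \<le> b" if "mog_grad x = 0" for x
  proof (rule ccontr)
    assume "\<not> norm x \<le> b"
    then have "0 < (\<Sum>k=1..K. mog_weight K w \<mu> S k x * (x \<bullet> score k x))"
      using K_pos by (intro sum_pos mult_pos_pos mog_weight_pos b) auto
    also have "\<dots> = x \<bullet> mog_grad x" by (simp add: mog_grad_def inner_sum_right)
    finally show False using that by simp
  qed
  then show ?thesis by (auto simp: bounded_iff)
qed

lemma mog_gradient_system:
  assumes R: "riemannian_metric R"
    and morse: "morse (\<lambda>x. - ln (mog K w \<mu> S x))"
    and complete: "complete_field (gradient_field R (mog K w \<mu> S))"
  shows "gradient_system (\<lambda>x. - ln (mog K w \<mu> S x)) (gradient_field R (mog K w \<mu> S)) mog_grad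
    (\<lambda>x. Blinfun (mog_hess x)) (\<lambda>x. Blinfun ((*v) (matrix_inv (R x))))"
proof
  show "GDERIV (\<lambda>x. - ln (mog K w \<mu> S x)) x :> mog_grad x" for x by (rule gderiv_neg_ln_mog)
  show "(mog_grad has_derivative blinfun_apply (Blinfun (mog_hess x))) (at x)" for x
    unfolding mog_hess_apply by (rule mog_grad_deriv)
  show "continuous_on UNIV (\<lambda>x. Blinfun (mog_hess x))" by (rule mog_hess_cont)
  show "Blinfun (mog_hess x) u \<bullet> v = u \<bullet> Blinfun (mog_hess x) v" for x u v
    unfolding mog_hess_apply by (rule mog_hess_sym)
  show "u = 0" if "mog_grad x = 0" "Blinfun (mog_hess x) u = 0" for x u
    using that morse unfolding morse_def grad_neg_ln_mog mog_hess_apply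
    by (metis hessian_neg_ln_mog matrix_inv_vector(2) matrix_vector_mult_0_right)
  show "gradient_field R (mog K w \<mu> S) x = - Blinfun ((*v) (matrix_inv (R x))) (mog_grad x)" for x
    unfolding gradient_field_mog[OF params] by (simp add: mog_grad_def score_def)
  show "0 < v \<bullet> Blinfun ((*v) (matrix_inv (R x))) v" if "v \<noteq> 0" for v x
    using that R sym_pos_def_matrix_inv[of "R x"]
    by (simp add: riemannian_metric_def sym_pos_def_def pos_def_def)
  show "\<exists>L. L-lipschitz_on (cball 0 r) (\<lambda>x. Blinfun ((*v) (matrix_inv (R x))))" for r
    by (rule metric_inverse_lipschitz[OF R])
  show "bounded {x. - ln (mog K w \<mu> S x) \<le> c}" for c by (rule neg_ln_mog_sublevel_bounded)
  show "bounded {x. mog_grad x = 0}" by (rule mog_grad_zeros_bounded)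
  show "complete_field (gradient_field R (mog K w \<mu> S))" by fact
qed

end

theorem theorem5p3:
  fixes K :: nat
    and w :: "nat \<Rightarrow> real"
    and \<mu> :: "nat \<Rightarrow> real^'n"
    and S :: "nat \<Rightarrow> real^'n^'n"
    and R :: "real^'n \<Rightarrow> real^'n^'n"
    and p f :: "real^'n \<Rightarrow> real"
    and F :: "real^'n \<Rightarrow> real^'n"
  assumes params: "mog_params K w \<mu> S"
    and p_def: "p = mog K w \<mu> S"
    and f_def: "f = (\<lambda>x. - ln (p x))"
    and F_def: "F = gradient_field R p"
    and metric: "riemannian_metric R"
    and cond: "finite_condition_number R"
    and morse: "morse f"
    and complete: "complete_field F"
  shows "finite (stable_equilibria f)
       \<and> (UNIV :: (real^'n) set) = (\<Union>a\<in>stable_equilibria f. basin_cell F a)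
       \<and> (\<forall>a\<in>stable_equilibria f. \<forall>b\<in>stable_equilibria f.
             a \<noteq> b \<longrightarrow> basin_cell F a \<inter> basin_cell F b \<in> null_sets lebesgue)"
proof -
  interpret gradient_system f F "mog_grad K w \<mu> S" "\<lambda>x. Blinfun (mog_hess K w \<mu> S x)"
    "\<lambda>x. Blinfun ((*v) (matrix_inv (R x)))"
    using mog_gradient_system[OF params metric] morse complete by (simp add: p_def f_def F_def)
  have st: "stable_equilibria f = stable"
    unfolding stable_equilibria_def stable_def pos_def_def f_def p_def
    by (simp add: grad_neg_ln_mog[OF params] hessian_neg_ln_mog[OF params] mog_hess_apply[OF params])
  have cell: "basin_cell F a = closure (basin a)" for a by (simp add: basin_cell_def basin_def)
  show ?thesis
    unfolding st cell
    using finite_stable stable_cells_cover stable_cells_overlap by (simp add: negligible_iff_null_sets)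
qed

end
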